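(* For flows there are the implications q-cofibrant $\Rightarrow$ m-cofibrant $\Rightarrow$ h-cofibrant; that is, every object of $\mathbf{Flow}$ that is cofibrant in the q-model structure is cofibrant in the m-model structure, and every object that is cofibrant in the m-model structure is cofibrant in the h-model structure. Moreover, the identity functor yields a Quillen equivalence $\mathrm{Id}:(\mathbf{Flow})_q\dashv(\mathbf{Flow})_m:\mathrm{Id}$ (with left adjoint going from the q-model structure to the m-model structure).
   Context: $\mathbf{Top}$ is the category of $\Delta$-generated spaces, i.e. topological spaces that are colimits of standard topological simplices. A q-fibration of $\mathbf{Top}$ is a map with the right lifting property with respect to the inclusions $\mathbf{D}^n\times\{0\}\subset \mathbf{D}^n\times[0,1]$, $n\ge 0$. An h-fibration is a map with the right lifting property with respect to $Z\times\{0\}\subset Z\times[0,1]$ for all spaces $Z$ of $\mathbf{Top}$. A flow $X$ consists of a space $\mathbb{P}X$ of $\mathbf{Top}$ (execution paths), a discrete space $X^0$ (states), two continuous maps $s,t:\mathbb{P}X\to X^0$ (source and target), and a continuous associative map $*:\{(x,y)\in\mathbb{P}X\times\mathbb{P}X\mid t(x)=s(y)\}\to\mathbb{P}X$ with $s(x*y)=s(x)$ and $t(x*y)=t(y)$ (no identities are required). A map of flows $f:X\to Y$ consists of a set map $f^0:X^0\to Y^0$ and a continuous map $\mathbb{P}f:\mathbb{P}X\to\mathbb{P}Y$ compatible with $s$, $t$ and $*$. The category is $\mathbf{Flow}$. $\mathbb{P}_{\alpha,\beta}X=\{x\in\mathbb{P}X\mid s(x)=\alpha,\ t(x)=\beta\}$.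 The q-, h- and m-model structures $(\mathbf{Flow})_q$, $(\mathbf{Flow})_h$, $(\mathbf{Flow})_m$ are the unique model structures such that $f:X\to Y$ is a weak equivalence iff $f^0$ is a bijection and each $\mathbb{P}_{\alpha,\beta}X\to \mathbb{P}_{f(\alpha),f(\beta)}Y$ belongs to $\mathcal{W}$, and a fibration iff each such map belongs to $\mathcal{F}$, where: for q, $\mathcal{W}$ = weak homotopy equivalences and $\mathcal{F}$ = q-fibrations; for h, $\mathcal{W}$ = homotopy equivalences and $\mathcal{F}$ = h-fibrations; for m, $\mathcal{W}$ = weak homotopy equivalences and $\mathcal{F}$ = h-fibrations. These model structures exist. *)

theory Defs
  imports "HOL-Homology.Simplices" "HOL-Library.Equipollence"
begin

section \<open>Categories, adjunctions and model structures\<close>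

record ('o, 'm) category =
  Obj :: "'o set"
  Arr :: "'m set"
  Dom :: "'m \<Rightarrow> 'o"
  Cod :: "'m \<Rightarrow> 'o"
  Ident :: "'o \<Rightarrow> 'm"
  Cmp :: "'m \<Rightarrow> 'm \<Rightarrow> 'm"  \<comment> \<open>\<open>Cmp C g f\<close> is \<open>g\<close> after \<open>f\<close>\<close>

definition arrows :: "('o, 'm) category \<Rightarrow> 'o \<Rightarrow> 'o \<Rightarrow> 'm set" where
  "arrows C X Y = {f \<in> Arr C. Dom C f = X \<and> Cod C f = Y}"

definition is_category :: "('o, 'm) category \<Rightarrow> bool" where
  "is_category C \<longleftrightarrow>
     (\<forall>f\<in>Arr C. Dom C f \<in> Obj C \<and> Cod C f \<in> Obj C) \<and>
     (\<forall>X\<in>Obj C. Ident C X \<in> arrows C X X) \<and>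
     (\<forall>f\<in>Arr C. \<forall>g\<in>Arr C. Dom C g = Cod C f \<longrightarrow> Cmp C g f \<in> arrows C (Dom C f) (Cod C g)) \<and>
     (\<forall>f\<in>Arr C. Cmp C f (Ident C (Dom C f)) = f \<and> Cmp C (Ident C (Cod C f)) f = f) \<and>
     (\<forall>f\<in>Arr C. \<forall>g\<in>Arr C. \<forall>h\<in>Arr C. Dom C g = Cod C f \<longrightarrow> Dom C h = Cod C g \<longrightarrow>
        Cmp C h (Cmp C g f) = Cmp C (Cmp C h g) f)"

definition initial_object :: "('o, 'm) category \<Rightarrow> 'o \<Rightarrow> bool" where
  "initial_object C I \<longleftrightarrow> I \<in> Obj C \<and> (\<forall>X\<in>Obj C. \<exists>!f. f \<in> arrows C I X)"

definition terminal_object :: "('o, 'm) category \<Rightarrow> 'o \<Rightarrow> bool" where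
  "terminal_object C T \<longleftrightarrow> T \<in> Obj C \<and> (\<forall>X\<in>Obj C. \<exists>!f. f \<in> arrows C X T)"

record ('o1, 'm1, 'o2, 'm2) functor_data =
  on_obj :: "'o1 \<Rightarrow> 'o2"
  on_arr :: "'m1 \<Rightarrow> 'm2"

definition is_functor ::
  "('o1, 'm1) category \<Rightarrow> ('o2, 'm2) category \<Rightarrow> ('o1, 'm1, 'o2, 'm2) functor_data \<Rightarrow> bool" where
  "is_functor C D F \<longleftrightarrow> is_category C \<and> is_category D \<and>
     (\<forall>X\<in>Obj C. on_obj F X \<in> Obj D \<and> on_arr F (Ident C X) = Ident D (on_obj F X)) \<and>
     (\<forall>f\<in>Arr C. on_arr F f \<in> arrows D (on_obj F (Dom C f)) (on_obj F (Cod C f))) \<and>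
     (\<forall>f\<in>Arr C. \<forall>g\<in>Arr C. Dom C g = Cod C f \<longrightarrow>
        on_arr F (Cmp C g f) = Cmp D (on_arr F g) (on_arr F f))"

definition identity_functor :: "('o, 'm, 'o, 'm) functor_data" where
  "identity_functor = \<lparr>on_obj = id, on_arr = id\<rparr>"

text \<open>\<open>\<phi> X Y\<close> is the bijection from the arrows \<open>F X \<rightarrow> Y\<close> to the arrows \<open>X \<rightarrow> G Y\<close>.\<close>

definition adjunction ::
  "('o1, 'm1) category \<Rightarrow> ('o2, 'm2) category \<Rightarrow> ('o1, 'm1, 'o2, 'm2) functor_data \<Rightarrow>
   ('o2, 'm2, 'o1, 'm1) functor_data \<Rightarrow> ('o1 \<Rightarrow> 'o2 \<Rightarrow> 'm2 \<Rightarrow> 'm1) \<Rightarrow> bool" where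
  "adjunction C D F G \<phi> \<longleftrightarrow> is_functor C D F \<and> is_functor D C G \<and>
     (\<forall>X\<in>Obj C. \<forall>Y\<in>Obj D.
        bij_betw (\<phi> X Y) (arrows D (on_obj F X) Y) (arrows C X (on_obj G Y))) \<and>
     (\<forall>a\<in>Arr C. \<forall>b\<in>Arr D. \<forall>f\<in>arrows D (on_obj F (Cod C a)) (Dom D b).
        \<phi> (Dom C a) (Cod D b) (Cmp D b (Cmp D f (on_arr F a)))
        = Cmp C (on_arr G b) (Cmp C (\<phi> (Cod C a) (Dom D b) f) a))"

definition has_lifting :: "('o, 'm) category \<Rightarrow> 'm \<Rightarrow> 'm \<Rightarrow> bool" where
  "has_lifting C i p \<longleftrightarrow>
     (\<forall>u\<in>arrows C (Dom C i) (Dom C p). \<forall>v\<in>arrows C (Cod C i) (Cod C p).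
        Cmp C p u = Cmp C v i \<longrightarrow>
        (\<exists>l\<in>arrows C (Cod C i) (Dom C p). Cmp C l i = u \<and> Cmp C p l = v))"

definition weak_factorization_system :: "('o, 'm) category \<Rightarrow> 'm set \<Rightarrow> 'm set \<Rightarrow> bool" where
  "weak_factorization_system C L R \<longleftrightarrow>
     L = {i \<in> Arr C. \<forall>p\<in>R. has_lifting C i p} \<and>
     R = {p \<in> Arr C. \<forall>i\<in>L. has_lifting C i p} \<and>
     (\<forall>f\<in>Arr C. \<exists>i\<in>L. \<exists>p\<in>R. Dom C p = Cod C i \<and> f = Cmp C p i)"

record 'm model_data =
  weqs :: "'m set"
  cofs :: "'m set"
  fibs :: "'m set"

definition model_structure :: "('o, 'm) category \<Rightarrow> 'm model_data \<Rightarrow> bool" where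
  "model_structure C M \<longleftrightarrow> is_category C \<and> weqs M \<subseteq> Arr C \<and>
     (\<forall>f\<in>Arr C. \<forall>g\<in>Arr C. Dom C g = Cod C f \<longrightarrow>
        (f \<in> weqs M \<and> g \<in> weqs M \<longrightarrow> Cmp C g f \<in> weqs M) \<and>
        (f \<in> weqs M \<and> Cmp C g f \<in> weqs M \<longrightarrow> g \<in> weqs M) \<and>
        (g \<in> weqs M \<and> Cmp C g f \<in> weqs M \<longrightarrow> f \<in> weqs M)) \<and>
     weak_factorization_system C (cofs M) (fibs M \<inter> weqs M) \<and>
     weak_factorization_system C (cofs M \<inter> weqs M) (fibs M)"

definition cofibrant :: "('o, 'm) category \<Rightarrow> 'm model_data \<Rightarrow> 'o \<Rightarrow> bool" where
  "cofibrant C M X \<longleftrightarrow> X \<in> Obj C \<and> (\<exists>I. initial_object C I \<and> (\<exists>f\<in>arrows C I X. f \<in> cofs M))"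

definition fibrant :: "('o, 'm) category \<Rightarrow> 'm model_data \<Rightarrow> 'o \<Rightarrow> bool" where
  "fibrant C M X \<longleftrightarrow> X \<in> Obj C \<and> (\<exists>T. terminal_object C T \<and> (\<exists>f\<in>arrows C X T. f \<in> fibs M))"

definition quillen_adjunction ::
  "('o1, 'm1) category \<Rightarrow> 'm1 model_data \<Rightarrow> ('o2, 'm2) category \<Rightarrow> 'm2 model_data \<Rightarrow>
   ('o1, 'm1, 'o2, 'm2) functor_data \<Rightarrow> ('o2, 'm2, 'o1, 'm1) functor_data \<Rightarrow>
   ('o1 \<Rightarrow> 'o2 \<Rightarrow> 'm2 \<Rightarrow> 'm1) \<Rightarrow> bool" where
  "quillen_adjunction C M D N F G \<phi> \<longleftrightarrow>
     model_structure C M \<and> model_structure D N \<and> adjunction C D F G \<phi> \<and>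
     on_arr F ` cofs M \<subseteq> cofs N \<and>
     on_arr F ` (cofs M \<inter> weqs M) \<subseteq> cofs N \<inter> weqs N"

definition quillen_equivalence ::
  "('o1, 'm1) category \<Rightarrow> 'm1 model_data \<Rightarrow> ('o2, 'm2) category \<Rightarrow> 'm2 model_data \<Rightarrow>
   ('o1, 'm1, 'o2, 'm2) functor_data \<Rightarrow> ('o2, 'm2, 'o1, 'm1) functor_data \<Rightarrow>
   ('o1 \<Rightarrow> 'o2 \<Rightarrow> 'm2 \<Rightarrow> 'm1) \<Rightarrow> bool" where
  "quillen_equivalence C M D N F G \<phi> \<longleftrightarrow>
     quillen_adjunction C M D N F G \<phi> \<and>
     (\<forall>X Y. cofibrant C M X \<longrightarrow> fibrant D N Y \<longrightarrow>
        (\<forall>f\<in>arrows D (on_obj F X) Y. f \<in> weqs N \<longleftrightarrow> \<phi> X Y f \<in> weqs M))"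


section \<open>Delta-generated spaces\<close>

abbreviation Simplex :: "nat \<Rightarrow> (nat \<Rightarrow> real) topology" where
  "Simplex n \<equiv> subtopology (powertop_real UNIV) (standard_simplex n)"

text \<open>
  Colimits in the category of all topological spaces are computed as the quotient of the disjoint
  sum of the vertices of the diagram by the equivalence relation generated by its edges. A diagram
  of simplices is given by a set \<open>I\<close> of vertices (of dimension \<open>d i\<close>) and a set \<open>E\<close> of edges
  \<open>(i, \<theta>, j)\<close>, \<open>\<theta>\<close> being a continuous map from the simplex at \<open>i\<close> to the simplex at \<open>j\<close>. The type
  of the vertices is no restriction: a colimit of simplices is also the colimit of the diagram of
  all its singular simplices, and these are of that type (see \<open>delta_generated_iff\<close>).
\<close>

definition edge_rel ::
  "('i \<Rightarrow> nat) \<Rightarrow> ('i \<times> ((nat \<Rightarrow> real) \<Rightarrow> (nat \<Rightarrow> real)) \<times> 'i) set \<Rightarrow>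
   (('i \<times> (nat \<Rightarrow> real)) \<times> ('i \<times> (nat \<Rightarrow> real))) set" where
  "edge_rel d E = {((i, p), (j, \<theta> p)) | i \<theta> j p. (i, \<theta>, j) \<in> E \<and> p \<in> standard_simplex (d i)}"

definition delta_generated :: "'a topology \<Rightarrow> bool" where
  "delta_generated X \<longleftrightarrow>
     (\<exists>(I :: (nat \<times> ((nat \<Rightarrow> real) \<Rightarrow> 'a)) set) d E q.
        (\<forall>(i, \<theta>, j)\<in>E. i \<in> I \<and> j \<in> I \<and> continuous_map (Simplex (d i)) (Simplex (d j)) \<theta>) \<and>
        quotient_map (sum_topology (\<lambda>i. Simplex (d i)) I) X q \<and>
        (\<forall>u\<in>Sigma I (\<lambda>i. standard_simplex (d i)). \<forall>v\<in>Sigma I (\<lambda>i. standard_simplex (d i)).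
           q u = q v \<longleftrightarrow> (u, v) \<in> (edge_rel d E \<union> (edge_rel d E)\<inverse>)\<^sup>*))"

text \<open>The coreflection of topological spaces into Delta-generated spaces.\<close>

definition delta_openin :: "'a topology \<Rightarrow> 'a set \<Rightarrow> bool" where
  "delta_openin X U \<longleftrightarrow> U \<subseteq> topspace X \<and>
     (\<forall>n \<sigma>. continuous_map (Simplex n) X \<sigma> \<longrightarrow>
        openin (Simplex n) {p \<in> standard_simplex n. \<sigma> p \<in> U})"

definition delta_kelleyfication :: "'a topology \<Rightarrow> 'a topology" where
  "delta_kelleyfication X = topology (delta_openin X)"

lemma istopology_delta_openin: "istopology (delta_openin X)"
  unfolding istopology_def
proof (intro conjI allI impI)
  fix S T assume S: "delta_openin X S" and T: "delta_openin X T"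
  have "{p \<in> standard_simplex n. \<sigma> p \<in> S \<inter> T}
      = {p \<in> standard_simplex n. \<sigma> p \<in> S} \<inter> {p \<in> standard_simplex n. \<sigma> p \<in> T}"
    for n and \<sigma> :: "(nat \<Rightarrow> real) \<Rightarrow> 'a" by auto
  then show "delta_openin X (S \<inter> T)"
    using S T by (auto simp: delta_openin_def intro: openin_Int)
next
  fix K assume K: "\<forall>S\<in>K. delta_openin X S"
  have "{p \<in> standard_simplex n. \<sigma> p \<in> \<Union>K} = (\<Union>S\<in>K. {p \<in> standard_simplex n. \<sigma> p \<in> S})"
    for n and \<sigma> :: "(nat \<Rightarrow> real) \<Rightarrow> 'a" by auto
  moreover have "\<Union>K \<subseteq> topspace X" using K by (auto simp: delta_openin_def)
  ultimately show "delta_openin X (\<Union>K)"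
    using K unfolding delta_openin_def by (auto intro!: openin_Union)
qed

lemma openin_delta_kelleyfication: "openin (delta_kelleyfication X) = delta_openin X"
  by (simp add: delta_kelleyfication_def istopology_delta_openin topology_inverse')

lemma topspace_delta_kelleyfication: "topspace (delta_kelleyfication X) = topspace X"
proof -
  have "delta_openin X (topspace X)"
    by (auto simp: delta_openin_def continuous_map_def Pi_def)
  then show ?thesis
    unfolding openin_delta_kelleyfication[symmetric]
    by (metis openin_delta_kelleyfication delta_openin_def openin_subset openin_topspace subset_antisym)
qed

lemma delta_generated_iff: "delta_generated X \<longleftrightarrow> delta_kelleyfication X = X"
proof
  assume "delta_generated X"
  then obtain I :: "(nat \<times> ((nat \<Rightarrow> real) \<Rightarrow> 'a)) set" and d q
    where q: "quotient_map (sum_topology (\<lambda>i. Simplex (d i)) I) X q"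
    unfolding delta_generated_def by blast
  have qc: "continuous_map (Simplex (d i)) X (\<lambda>p. q (i, p))" if "i \<in> I" for i
    using continuous_map_compose[OF continuous_map_component_injection[OF that]
        quotient_imp_continuous_map[OF q]]
    by (simp add: o_def)
  have "openin X U" if U: "delta_openin X U" for U
  proof -
    have "openin (sum_topology (\<lambda>i. Simplex (d i)) I)
            {u \<in> topspace (sum_topology (\<lambda>i. Simplex (d i)) I). q u \<in> U}"
      unfolding openin_sum_topology
    proof (intro conjI ballI)
      fix i assume i: "i \<in> I"
      have "openin (Simplex (d i)) {p \<in> standard_simplex (d i). q (i, p) \<in> U}"
        using U qc[OF i] unfolding delta_openin_def by blast
      moreover have "{p \<in> standard_simplex (d i). q (i, p) \<in> U}
         = {x. (i, x) \<in> {u \<in> topspace (sum_topology (\<lambda>i. Simplex (d i)) I). q u \<in> U}}"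
        using i by auto
      ultimately show "openin (Simplex (d i))
         {x. (i, x) \<in> {u \<in> topspace (sum_topology (\<lambda>i. Simplex (d i)) I). q u \<in> U}}"
        by simp
    qed auto
    then show ?thesis
      using q U unfolding quotient_map_def delta_openin_def by blast
  qed
  moreover have "delta_openin X U" if "openin X U" for U
    using that openin_subset openin_continuous_map_preimage
    by (fastforce simp: delta_openin_def)
  ultimately show "delta_kelleyfication X = X"
    by (auto simp: topology_eq openin_delta_kelleyfication)
next
  assume X: "delta_kelleyfication X = X"
  define I where "I = {(n, \<sigma>). continuous_map (Simplex n) X \<sigma>}"
  define E where "E = {(i, \<theta>, j). i \<in> I \<and> j \<in> I \<and>
     continuous_map (Simplex (fst i)) (Simplex (fst j)) \<theta> \<and>
     (\<forall>p\<in>standard_simplex (fst i). snd j (\<theta> p) = snd i p)}"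
  define q where "q = (\<lambda>(i :: nat \<times> ((nat \<Rightarrow> real) \<Rightarrow> 'a), p). snd i p)"
  let ?R = "edge_rel fst E"
  let ?S = "sum_topology (\<lambda>i. Simplex (fst i)) I"
  define e :: "nat \<Rightarrow> real" where "e = (\<lambda>j. if j = 0 then 1 else 0)"
  have e: "e \<in> standard_simplex n" for n by (simp add: e_def)
  have const: "(0, \<lambda>_. x) \<in> I" if "x \<in> topspace X" for x
    using that by (simp add: I_def)
  have into: "snd i p \<in> topspace X" if "i \<in> I" "p \<in> standard_simplex (fst i)" for i p
    using that by (auto simp: I_def continuous_map_def)
  have "quotient_map ?S X q"
    unfolding quotient_map_def
  proof (intro conjI allI impI)
    show "q ` topspace ?S = topspace X"
    proof
      show "q ` topspace ?S \<subseteq> topspace X" using into by (auto simp: q_def)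
      show "topspace X \<subseteq> q ` topspace ?S"
      proof
        fix x assume x: "x \<in> topspace X"
        have "((0, \<lambda>_. x), e) \<in> topspace ?S" using const[OF x] e by auto
        moreover have "q ((0, \<lambda>_. x), e) = x" by (simp add: q_def)
        ultimately show "x \<in> q ` topspace ?S" by (metis imageI)
      qed
    qed
    fix U assume U: "U \<subseteq> topspace X"
    have eq: "{x. (i, x) \<in> {u \<in> topspace ?S. q u \<in> U}}
       = {p \<in> standard_simplex (fst i). snd i p \<in> U}" if "i \<in> I" for i
      using that by (auto simp: q_def)
    have "openin ?S {u \<in> topspace ?S. q u \<in> U} \<longleftrightarrow>
        (\<forall>i\<in>I. openin (Simplex (fst i)) {p \<in> standard_simplex (fst i). snd i p \<in> U})"
      unfolding openin_sum_topology using eq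
      by (simp del: mem_Collect_eq topspace_subtopology cong: ball_cong)
    also have "\<dots> \<longleftrightarrow> delta_openin X U" using U by (auto simp: delta_openin_def I_def)
    also have "\<dots> \<longleftrightarrow> openin X U" by (metis X openin_delta_kelleyfication)
    finally show "openin ?S {u \<in> topspace ?S. q u \<in> U} = openin X U" .
  qed
  moreover have "q u = q v \<longleftrightarrow> (u, v) \<in> (?R \<union> ?R\<inverse>)\<^sup>*"
    if u: "u \<in> Sigma I (\<lambda>i. standard_simplex (fst i))"
      and v: "v \<in> Sigma I (\<lambda>i. standard_simplex (fst i))" for u v
  proof
    assume "(u, v) \<in> (?R \<union> ?R\<inverse>)\<^sup>*"
    then show "q u = q v"
      by (induction) (auto simp: edge_rel_def E_def q_def)
  next
    assume eq: "q u = q v"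
    define x where "x = q u"
    have x: "x \<in> topspace X" using u into by (auto simp: x_def q_def)
    have *: "(((0, \<lambda>_. x), e), w) \<in> ?R"
      if w: "w \<in> Sigma I (\<lambda>i. standard_simplex (fst i))" "q w = x" for w
    proof -
      obtain i p where ip: "w = (i, p)" "i \<in> I" "p \<in> standard_simplex (fst i)" "snd i p = x"
        using w by (auto simp: q_def)
      have "((0, \<lambda>_. x), (\<lambda>_. p), i) \<in> E"
        using ip const[OF x] by (simp add: E_def)
      then show ?thesis
        unfolding edge_rel_def using ip(1) e[of 0] by fastforce
    qed
    have "(u, ((0, \<lambda>_. x), e)) \<in> (?R \<union> ?R\<inverse>)\<^sup>*" using *[OF u] x_def by auto
    moreover have "(((0, \<lambda>_. x), e), v) \<in> (?R \<union> ?R\<inverse>)\<^sup>*" using *[OF v] x_def eq by auto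
    ultimately show "(u, v) \<in> (?R \<union> ?R\<inverse>)\<^sup>*" by (rule rtrancl_trans)
  qed
  moreover have "\<forall>(i, \<theta>, j)\<in>E. i \<in> I \<and> j \<in> I \<and>
      continuous_map (Simplex (fst i)) (Simplex (fst j)) \<theta>"
    by (auto simp: E_def)
  ultimately show "delta_generated X"
    unfolding delta_generated_def by blast
qed

text \<open>
  The type \<open>'u\<close> plays the role of the universe: a set is small if it has the size of a subset of
  \<open>'u\<close> of smaller cardinality than \<open>'u\<close>. If \<open>'u\<close> has inaccessible cardinality, these are the small
  sets of a Grothendieck universe.
\<close>

definition Top :: "'u topology set" where
  "Top = {X. delta_generated X \<and> topspace X \<prec> (UNIV :: 'u set)}"


section \<open>Fibrations and weak equivalences of spaces\<close>

definition unit_interval :: "real topology" where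
  "unit_interval = top_of_set {0..1}"

text \<open>
  The right lifting property of \<open>p : E \<rightarrow> B\<close> with respect to the inclusion \<open>Z \<times> {0} \<subseteq> Z \<times> [0,1]\<close>.
  Since \<open>[0,1]\<close> is locally compact, for \<open>Z\<close> Delta-generated the product topology on \<open>Z \<times> [0,1]\<close> is
  Delta-generated, i.e. it is the product in \<open>Top\<close>.
\<close>

definition homotopy_lifting ::
  "'z topology \<Rightarrow> 'a topology \<Rightarrow> 'b topology \<Rightarrow> ('a \<Rightarrow> 'b) \<Rightarrow> bool" where
  "homotopy_lifting Z E B p \<longleftrightarrow>
     (\<forall>g h. continuous_map (subtopology (prod_topology Z unit_interval) (topspace Z \<times> {0})) E g \<longrightarrow>
            continuous_map (prod_topology Z unit_interval) B h \<longrightarrow>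
            (\<forall>w\<in>topspace Z \<times> {0}. p (g w) = h w) \<longrightarrow>
            (\<exists>l. continuous_map (prod_topology Z unit_interval) E l \<and>
                 (\<forall>w\<in>topspace Z \<times> {0}. l w = g w) \<and>
                 (\<forall>w\<in>topspace Z \<times> {0..1}. p (l w) = h w)))"

definition Disc :: "nat \<Rightarrow> (nat \<Rightarrow> real) topology" where
  "Disc n = subtopology (Euclidean_space n) {x. (\<Sum>i<n. (x i)\<^sup>2) \<le> 1}"

definition q_fibration :: "'u topology \<Rightarrow> 'u topology \<Rightarrow> ('u \<Rightarrow> 'u) \<Rightarrow> bool" where
  "q_fibration E B p \<longleftrightarrow> continuous_map E B p \<and> (\<forall>n. homotopy_lifting (Disc n) E B p)"

definition h_fibration :: "'u topology \<Rightarrow> 'u topology \<Rightarrow> ('u \<Rightarrow> 'u) \<Rightarrow> bool" where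
  "h_fibration E B p \<longleftrightarrow>
     continuous_map E B p \<and> (\<forall>Z \<in> (Top :: 'u topology set). homotopy_lifting Z E B p)"

definition homotopy_equivalence :: "'a topology \<Rightarrow> 'b topology \<Rightarrow> ('a \<Rightarrow> 'b) \<Rightarrow> bool" where
  "homotopy_equivalence X Y f \<longleftrightarrow> continuous_map X Y f \<and>
     (\<exists>g. continuous_map Y X g \<and>
          homotopic_with (\<lambda>_. True) X X (g \<circ> f) id \<and>
          homotopic_with (\<lambda>_. True) Y Y (f \<circ> g) id)"

definition Cube :: "nat \<Rightarrow> (nat \<Rightarrow> real) topology" where
  "Cube n = subtopology (Euclidean_space n) {x. \<forall>i<n. 0 \<le> x i \<and> x i \<le> 1}"

definition cube_boundary :: "nat \<Rightarrow> (nat \<Rightarrow> real) set" where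
  "cube_boundary n = {x \<in> topspace (Cube n). \<exists>i<n. x i = 0 \<or> x i = 1}"

definition based_cubes :: "nat \<Rightarrow> 'a topology \<Rightarrow> 'a \<Rightarrow> ((nat \<Rightarrow> real) \<Rightarrow> 'a) set" where
  "based_cubes n X x = {\<alpha>. continuous_map (Cube n) X \<alpha> \<and> (\<forall>p\<in>cube_boundary n. \<alpha> p = x)}"

definition based_homotopy ::
  "nat \<Rightarrow> 'a topology \<Rightarrow> 'a \<Rightarrow> (((nat \<Rightarrow> real) \<Rightarrow> 'a) \<times> ((nat \<Rightarrow> real) \<Rightarrow> 'a)) set" where
  "based_homotopy n X x =
     {(\<alpha>, \<beta>). \<alpha> \<in> based_cubes n X x \<and> \<beta> \<in> based_cubes n X x \<and>
        homotopic_with (\<lambda>\<gamma>. \<forall>p\<in>cube_boundary n. \<gamma> p = x) (Cube n) X \<alpha> \<beta>}"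

text \<open>The underlying set of the \<open>n\<close>-th homotopy group of \<open>X\<close> at \<open>x\<close>, for \<open>n \<ge> 1\<close>.\<close>

definition homotopy_group :: "nat \<Rightarrow> 'a topology \<Rightarrow> 'a \<Rightarrow> ((nat \<Rightarrow> real) \<Rightarrow> 'a) set set" where
  "homotopy_group n X x = based_cubes n X x // based_homotopy n X x"

definition homotopy_group_map ::
  "nat \<Rightarrow> 'b topology \<Rightarrow> 'b \<Rightarrow> ('a \<Rightarrow> 'b) \<Rightarrow>
   ((nat \<Rightarrow> real) \<Rightarrow> 'a) set \<Rightarrow> ((nat \<Rightarrow> real) \<Rightarrow> 'b) set" where
  "homotopy_group_map n Y y f c = based_homotopy n Y y `` ((\<lambda>\<alpha>. f \<circ> \<alpha>) ` c)"

text \<open>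
  The maps induced on homotopy groups are group homomorphisms, so that they are isomorphisms iff
  they are bijective.
\<close>

definition weak_homotopy_equivalence :: "'a topology \<Rightarrow> 'b topology \<Rightarrow> ('a \<Rightarrow> 'b) \<Rightarrow> bool" where
  "weak_homotopy_equivalence X Y f \<longleftrightarrow> continuous_map X Y f \<and>
     bij_betw (\<lambda>c. {y. \<exists>x\<in>c. path_component_of Y (f x) y})
        (path_components_of X) (path_components_of Y) \<and>
     (\<forall>n\<ge>1. \<forall>x\<in>topspace X.
        bij_betw (homotopy_group_map n Y (f x) f) (homotopy_group n X x) (homotopy_group n Y (f x)))"


section \<open>Flows\<close>

record 'u flow =
  states :: "'u set"
  paths :: "'u topology"
  src :: "'u \<Rightarrow> 'u"
  tgt :: "'u \<Rightarrow> 'u"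
  pconcat :: "'u \<times> 'u \<Rightarrow> 'u"

text \<open>The pullback of \<open>tgt\<close> and \<open>src\<close>, formed in \<open>Top\<close>.\<close>

definition composable_paths :: "'u flow \<Rightarrow> ('u \<times> 'u) topology" where
  "composable_paths X = delta_kelleyfication
     (subtopology (prod_topology (paths X) (paths X)) {(x, y). tgt X x = src X y})"

text \<open>
  The maps of a flow, and those of a map of flows, are required to be \<open>undefined\<close> off their
  domains, so that equality in HOL is equality of flows and of maps of flows.
\<close>

definition is_flow :: "'u flow \<Rightarrow> bool" where
  "is_flow X \<longleftrightarrow>
     states X \<prec> (UNIV :: 'u set) \<and> paths X \<in> Top \<and>
     src X \<in> extensional (topspace (paths X)) \<and>
     tgt X \<in> extensional (topspace (paths X)) \<and>
     pconcat X \<in> extensional (topspace (composable_paths X)) \<and>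
     continuous_map (paths X) (discrete_topology (states X)) (src X) \<and>
     continuous_map (paths X) (discrete_topology (states X)) (tgt X) \<and>
     continuous_map (composable_paths X) (paths X) (pconcat X) \<and>
     (\<forall>x\<in>topspace (paths X). \<forall>y\<in>topspace (paths X). tgt X x = src X y \<longrightarrow>
        src X (pconcat X (x, y)) = src X x \<and> tgt X (pconcat X (x, y)) = tgt X y) \<and>
     (\<forall>x\<in>topspace (paths X). \<forall>y\<in>topspace (paths X). \<forall>z\<in>topspace (paths X).
        tgt X x = src X y \<longrightarrow> tgt X y = src X z \<longrightarrow>
        pconcat X (pconcat X (x, y), z) = pconcat X (x, pconcat X (y, z)))"

record 'u flow_map =
  dom_flow :: "'u flow"
  cod_flow :: "'u flow"
  on_states :: "'u \<Rightarrow> 'u"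
  on_paths :: "'u \<Rightarrow> 'u"

definition is_flow_map :: "'u flow_map \<Rightarrow> bool" where
  "is_flow_map f \<longleftrightarrow>
     (let X = dom_flow f; Y = cod_flow f in
      is_flow X \<and> is_flow Y \<and>
      on_states f \<in> states X \<rightarrow>\<^sub>E states Y \<and>
      on_paths f \<in> extensional (topspace (paths X)) \<and>
      continuous_map (paths X) (paths Y) (on_paths f) \<and>
      (\<forall>x\<in>topspace (paths X).
         src Y (on_paths f x) = on_states f (src X x) \<and>
         tgt Y (on_paths f x) = on_states f (tgt X x)) \<and>
      (\<forall>x\<in>topspace (paths X). \<forall>y\<in>topspace (paths X). tgt X x = src X y \<longrightarrow>
         on_paths f (pconcat X (x, y)) = pconcat Y (on_paths f x, on_paths f y)))"

definition Flow :: "('u flow, 'u flow_map) category" where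
  "Flow = \<lparr>
     Obj = {X. is_flow X},
     Arr = {f. is_flow_map f},
     Dom = dom_flow,
     Cod = cod_flow,
     Ident = (\<lambda>X. \<lparr>dom_flow = X, cod_flow = X,
       on_states = restrict id (states X), on_paths = restrict id (topspace (paths X))\<rparr>),
     Cmp = (\<lambda>g f. \<lparr>dom_flow = dom_flow f, cod_flow = cod_flow g,
       on_states = compose (states (dom_flow f)) (on_states g) (on_states f),
       on_paths = compose (topspace (paths (dom_flow f))) (on_paths g) (on_paths f)\<rparr>)\<rparr>"

lemma topspace_composable_paths:
  "topspace (composable_paths X) =
     {(x, y). x \<in> topspace (paths X) \<and> y \<in> topspace (paths X) \<and> tgt X x = src X y}"
  by (auto simp: composable_paths_def topspace_delta_kelleyfication)

lemma is_flow_pconcat: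
  assumes "is_flow X" "x \<in> topspace (paths X)" "y \<in> topspace (paths X)" "tgt X x = src X y"
  shows "pconcat X (x, y) \<in> topspace (paths X)"
  using assms by (auto simp: is_flow_def continuous_map_def topspace_composable_paths Pi_iff)

lemma is_flow_states:
  assumes "is_flow X" "x \<in> topspace (paths X)"
  shows "src X x \<in> states X" "tgt X x \<in> states X"
  using assms by (auto simp: is_flow_def continuous_map_def Pi_iff)

lemma is_flow_map_cmp:
  assumes f: "is_flow_map f" and g: "is_flow_map g" and fg: "dom_flow g = cod_flow f"
  shows "is_flow_map (Cmp Flow g f)"
proof -
  have "continuous_map (paths (dom_flow f)) (paths (cod_flow g)) (on_paths g \<circ> on_paths f)"
    using f g fg by (auto simp: is_flow_map_def Let_def intro: continuous_map_compose)
  then have c: "continuous_map (paths (dom_flow f)) (paths (cod_flow g))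
      (compose (topspace (paths (dom_flow f))) (on_paths g) (on_paths f))"
    by (rule continuous_map_eq) (simp add: compose_def)
  have F: "is_flow (dom_flow f)" using f by (simp add: is_flow_map_def Let_def)
  have fp: "on_paths f x \<in> topspace (paths (cod_flow f))" if "x \<in> topspace (paths (dom_flow f))" for x
    using f that by (auto simp: is_flow_map_def Let_def continuous_map_def Pi_iff)
  show ?thesis
    using f g fg c fp is_flow_pconcat[OF F] is_flow_states[OF F]
    by (simp add: Flow_def is_flow_map_def Let_def compose_def PiE_iff)
qed

lemma is_flow_map_ident: "is_flow X \<Longrightarrow> is_flow_map (Ident Flow X)"
proof -
  assume X: "is_flow X"
  have "continuous_map (paths X) (paths X) (restrict id (topspace (paths X)))"
    using continuous_map_id by (rule continuous_map_eq) simp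
  then show ?thesis
    using X is_flow_pconcat[OF X] is_flow_states[OF X]
    by (simp add: Flow_def is_flow_map_def Let_def)
qed

lemma is_category_Flow: "is_category (Flow :: ('a flow, 'a flow_map) category)"
proof -
  have "is_flow (dom_flow f)" "is_flow (cod_flow f)" if "is_flow_map f" for f :: "'a flow_map"
    using that by (auto simp: is_flow_map_def Let_def)
  moreover have "Cmp Flow f (Ident Flow (dom_flow f)) = f" "Cmp Flow (Ident Flow (cod_flow f)) f = f"
    if "is_flow_map f" for f :: "'a flow_map"
    using that
    by (auto simp: Flow_def is_flow_map_def Let_def compose_def continuous_map_def fun_eq_iff
        extensional_def PiE_iff Pi_iff intro!: flow_map.equality)
  moreover have "Cmp Flow h (Cmp Flow g f) = Cmp Flow (Cmp Flow h g) f"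
    if "is_flow_map f" "is_flow_map g" "dom_flow g = cod_flow f" for f g h :: "'a flow_map"
    using that
    by (auto simp: Flow_def is_flow_map_def Let_def compose_def continuous_map_def fun_eq_iff
        PiE_iff Pi_iff intro!: flow_map.equality)
  moreover have "arrows Flow X Y = {f. is_flow_map f \<and> dom_flow f = X \<and> cod_flow f = Y}"
    for X Y :: "'a flow" by (auto simp: arrows_def Flow_def)
  moreover have "dom_flow (Cmp Flow g f) = dom_flow f" "cod_flow (Cmp Flow g f) = cod_flow g"
    "dom_flow (Ident Flow X) = X" "cod_flow (Ident Flow X) = X" for f g :: "'a flow_map" and X :: "'a flow"
    by (auto simp: Flow_def)
  moreover have "Obj Flow = {X :: 'a flow. is_flow X}" "Arr Flow = {f :: 'a flow_map. is_flow_map f}"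
    "Dom Flow = (dom_flow :: 'a flow_map \<Rightarrow> _)" "Cod Flow = (cod_flow :: 'a flow_map \<Rightarrow> _)"
    by (simp_all add: Flow_def)
  ultimately show ?thesis
    using is_flow_map_cmp is_flow_map_ident
    unfolding is_category_def by auto
qed
definition path_space :: "'u flow \<Rightarrow> 'u \<Rightarrow> 'u \<Rightarrow> 'u topology" where
  "path_space X a b = subtopology (paths X) {x \<in> topspace (paths X). src X x = a \<and> tgt X x = b}"

definition locally_in ::
  "('u topology \<Rightarrow> 'u topology \<Rightarrow> ('u \<Rightarrow> 'u) \<Rightarrow> bool) \<Rightarrow> 'u flow_map \<Rightarrow> bool" where
  "locally_in K f \<longleftrightarrow>
     (\<forall>a\<in>states (dom_flow f). \<forall>b\<in>states (dom_flow f).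
        K (path_space (dom_flow f) a b)
          (path_space (cod_flow f) (on_states f a) (on_states f b)) (on_paths f))"

text \<open>
  By the lifting and factorization axioms, a model structure is determined by its weak
  equivalences and its fibrations, so that each of the following three predicates has at most one
  solution \<open>M\<close>.
\<close>

definition flow_model_structure ::
  "('u topology \<Rightarrow> 'u topology \<Rightarrow> ('u \<Rightarrow> 'u) \<Rightarrow> bool) \<Rightarrow>
   ('u topology \<Rightarrow> 'u topology \<Rightarrow> ('u \<Rightarrow> 'u) \<Rightarrow> bool) \<Rightarrow> 'u flow_map model_data \<Rightarrow> bool" where
  "flow_model_structure W F M \<longleftrightarrow> model_structure Flow M \<and>
     weqs M = {f \<in> Arr Flow.
       bij_betw (on_states f) (states (dom_flow f)) (states (cod_flow f)) \<and> locally_in W f} \<and>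
     fibs M = {f \<in> Arr Flow. locally_in F f}"

definition is_q_model_structure :: "'u flow_map model_data \<Rightarrow> bool" where
  "is_q_model_structure = flow_model_structure weak_homotopy_equivalence q_fibration"

definition is_h_model_structure :: "'u flow_map model_data \<Rightarrow> bool" where
  "is_h_model_structure = flow_model_structure homotopy_equivalence h_fibration"

definition is_m_model_structure :: "'u flow_map model_data \<Rightarrow> bool" where
  "is_m_model_structure = flow_model_structure weak_homotopy_equivalence h_fibration"

end

(*
  The q- and the m-structure have the same weak equivalences, the m- and the h-structure the same
  fibrations. Hence everything follows by lifting from two inclusions of classes of maps of spaces.

  Every h-fibration is a q-fibration, since discs are Delta-generated, being retracts of simplices.

  Every homotopy equivalence of Delta-generated spaces is a weak homotopy equivalence. Instead of
  moving base points along homotopies, the argument uses the m-model structure: the inclusion of the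
  bottom of a cylinder has the left lifting property against h-fibrations, so that (passing to the
  globes Glob(X) -> Glob(X x [0,1])) it is a weak equivalence. By two-out-of-three all maps homotopic
  to an identity are weak equivalences. If g is a homotopy inverse of f, this applies to g o f and
  f o g, and two-out-of-six gives the claim for f.
*)

theory Submission
  imports Defs "HOL-Analysis.Abstract_Topological_Spaces"
begin

section \<open>Delta-generated spaces\<close>

text \<open>The obstacle is base points. If \<open>f\<close> and \<open>g \<circ> f\<close> are weak
  homotopy equivalences, they control the homotopy groups of \<open>g\<close> only at points in the
  image of \<open>f\<close>; every other point has to be reached along a path. For maps between
  globes this case is part of the two-out-of-three axiom of the given m-structure, so it need not be
  proved by hand. The cylinder enters in the same spirit: trivial cofibrations are exactly the maps
  lifting against all fibrations, hence a lifting property alone certifies a weak homotopy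
  equivalence. The second constraint is size and type. \<open>Top\<close> consists of topologies on
  \<open>'u\<close> itself, whereas discs consist of sequences of reals and cylinders of pairs. Both
  are copied into \<open>'u\<close>, which uses that the reals are smaller than \<open>'u\<close>.
  Conversely, the results on spaces apply to a flow only because its path spaces lie in
  \<open>Top\<close>, and this rests on the discreteness of the states.\<close>

lemma delta_generatedI:
  assumes "\<And>U. delta_openin X U \<Longrightarrow> openin X U"
  shows "delta_generated X"
proof -
  have "delta_openin X U" if "openin X U" for U
    using that openin_subset openin_continuous_map_preimage
    by (fastforce simp: delta_openin_def)
  with assms show ?thesis
    by (auto simp: delta_generated_iff topology_eq openin_delta_kelleyfication)
qed

lemma delta_generatedD: "delta_generated X \<Longrightarrow> delta_openin X U \<Longrightarrow> openin X U"
  by (metis delta_generated_iff openin_delta_kelleyfication)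

lemma delta_openin_preimage:
  assumes U: "delta_openin X U" and r: "continuous_map Y X r"
  shows "delta_openin Y {y \<in> topspace Y. r y \<in> U}"
  unfolding delta_openin_def
proof (intro conjI allI impI)
  fix n and \<sigma> :: "(nat \<Rightarrow> real) \<Rightarrow> _" assume \<sigma>: "continuous_map (Simplex n) Y \<sigma>"
  have "continuous_map (Simplex n) X (r \<circ> \<sigma>)" by (rule continuous_map_compose[OF \<sigma> r])
  then have "openin (Simplex n) {p \<in> standard_simplex n. (r \<circ> \<sigma>) p \<in> U}"
    using U unfolding delta_openin_def by blast
  moreover have "{p \<in> standard_simplex n. (r \<circ> \<sigma>) p \<in> U}
      = {p \<in> standard_simplex n. \<sigma> p \<in> {y \<in> topspace Y. r y \<in> U}}"
    using \<sigma> by (auto simp: continuous_map_def)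
  ultimately show "openin (Simplex n) {p \<in> standard_simplex n. \<sigma> p \<in> {y \<in> topspace Y. r y \<in> U}}"
    by simp
qed auto

text \<open>Delta-openness pulls back along \<open>r\<close>, openness along \<open>s\<close>, and
  the two preimages compose to the identity. Prisms, discs, homeomorphic copies and path spaces are
  all treated as retracts.\<close>

lemma delta_generated_retract:
  assumes Y: "delta_generated Y" and r: "continuous_map Y X r" and s: "continuous_map X Y s"
    and rs: "\<And>x. x \<in> topspace X \<Longrightarrow> r (s x) = x"
  shows "delta_generated X"
proof (rule delta_generatedI)
  fix U assume U: "delta_openin X U"
  define V where "V = {y \<in> topspace Y. r y \<in> U}"
  have "openin Y V" unfolding V_def by (rule delta_generatedD[OF Y delta_openin_preimage[OF U r]])
  then have "openin X {x \<in> topspace X. s x \<in> V}" by (rule openin_continuous_map_preimage[OF s])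
  moreover have "{x \<in> topspace X. s x \<in> V} = U"
    using U s rs by (auto simp: V_def delta_openin_def continuous_map_def)
  ultimately show "openin X U" by simp
qed

section \<open>Simplices, prisms, cylinders and discs\<close>

lemma delta_generated_Simplex: "delta_generated (Simplex n)"
proof (rule delta_generatedI)
  fix U assume U: "delta_openin (Simplex n) U"
  have "openin (Simplex n) {p \<in> standard_simplex n. id p \<in> U}"
    using U continuous_map_id unfolding delta_openin_def by blast
  moreover have "{p \<in> standard_simplex n. id p \<in> U} = U"
    using U by (auto simp: delta_openin_def)
  ultimately show "openin (Simplex n) U" by simp
qed

lemma continuous_map_coordinate: "continuous_map (subtopology (powertop_real UNIV) S) euclideanreal (\<lambda>x. x i)"
  by (intro continuous_map_from_subtopology continuous_map_product_projection) simp

lemma continuous_map_into_powertop_real: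
  "continuous_map X (subtopology (powertop_real UNIV) S) f \<longleftrightarrow>
     (\<forall>i. continuous_map X euclideanreal (\<lambda>x. f x i)) \<and> f \<in> topspace X \<rightarrow> S"
  by (auto simp: continuous_map_in_subtopology continuous_map_componentwise_UNIV)

lemma continuous_map_into_unit_interval:
  "continuous_map X unit_interval f \<longleftrightarrow> continuous_map X euclideanreal f \<and> f \<in> topspace X \<rightarrow> {0..1}"
  by (auto simp: unit_interval_def continuous_map_in_subtopology)

lemma topspace_unit_interval [simp]: "topspace unit_interval = {0..1}"
  by (simp add: unit_interval_def)

lemma continuous_map_prism_coordinates:
  "continuous_map (prod_topology (Simplex n) unit_interval) euclideanreal (\<lambda>z. fst z i)"
  "continuous_map (prod_topology (Simplex n) unit_interval) euclideanreal snd"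
proof -
  show "continuous_map (prod_topology (Simplex n) unit_interval) euclideanreal (\<lambda>z. fst z i)"
    using continuous_map_compose[OF continuous_map_fst continuous_map_coordinate]
    by (simp add: o_def)
  show "continuous_map (prod_topology (Simplex n) unit_interval) euclideanreal snd"
    using continuous_map_snd continuous_map_into_unit_interval by blast
qed

lemma sum_atMost_split:
  fixes q :: "nat \<Rightarrow> real"
  shows "(\<Sum>i\<le>n + Suc m. q i) = (\<Sum>i\<le>n. q i) + (\<Sum>i\<le>m. q (i + Suc n))"
  by (induction m) (simp_all add: algebra_simps)

text \<open>
  The prism is a retract of a simplex of dimension \<open>2 n + 1\<close>, embedded by
  \<open>(p, t) \<mapsto> (t p, (1 - t) p)\<close>.
\<close>

lemma delta_generated_prism: "delta_generated (prod_topology (Simplex n) unit_interval)"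
proof (rule delta_generated_retract[OF delta_generated_Simplex])
  define s :: "(nat \<Rightarrow> real) \<times> real \<Rightarrow> nat \<Rightarrow> real" where
    "s = (\<lambda>z i. if i \<le> n then snd z * fst z i
               else if i \<le> n + Suc n then (1 - snd z) * fst z (i - Suc n) else 0)"
  \<comment> \<open>Adding the two halves gives \<open>t p + (1 - t) p = p\<close>; the first half
    sums to \<open>t\<close> because \<open>p\<close> sums to 1. There are \<open>2 n + 2\<close>
    coordinates, so the second half starts at index \<open>Suc n\<close>.\<close>
  define r :: "(nat \<Rightarrow> real) \<Rightarrow> (nat \<Rightarrow> real) \<times> real" where
    "r = (\<lambda>q. (\<lambda>i. if i \<le> n then q i + q (i + Suc n) else 0, \<Sum>i\<le>n. q i))"
  have sum_s: "(\<Sum>i\<le>n. s z i) = snd z * (\<Sum>i\<le>n. fst z i)"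
    "(\<Sum>i\<le>n. s z (i + Suc n)) = (1 - snd z) * (\<Sum>i\<le>n. fst z i)" for z
    by (auto simp: s_def sum_distrib_left)
  show "continuous_map (prod_topology (Simplex n) unit_interval) (Simplex (n + Suc n)) s"
    unfolding continuous_map_into_powertop_real
  proof (intro conjI allI funcsetI)
    show "continuous_map (prod_topology (Simplex n) unit_interval) euclideanreal (\<lambda>z. s z i)" for i
      unfolding s_def
      by (cases "i \<le> n"; cases "i \<le> n + Suc n")
         (auto intro!: continuous_map_real_mult continuous_map_prism_coordinates continuous_map_diff)
    fix z assume "z \<in> topspace (prod_topology (Simplex n) unit_interval)"
    then have z: "fst z \<in> standard_simplex n" "snd z \<in> {0..1}" by auto
    have "(\<Sum>i\<le>n + Suc n. s z i) = 1"
      using z by (simp add: sum_atMost_split sum_s del: sum.atMost_Suc add_Suc_right)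
         (simp add: standard_simplex_def algebra_simps)
    moreover have "0 \<le> s z i \<and> s z i \<le> 1" for i
      using z by (auto simp: s_def standard_simplex_def mult_le_one)
    ultimately show "s z \<in> standard_simplex (n + Suc n)"
      by (auto simp: standard_simplex_def s_def)
  qed
  show "continuous_map (Simplex (n + Suc n)) (prod_topology (Simplex n) unit_interval) r"
    unfolding continuous_map_pairwise o_def continuous_map_into_powertop_real continuous_map_into_unit_interval
  proof (intro conjI allI funcsetI)
    show "continuous_map (Simplex (n + Suc n)) euclideanreal (\<lambda>x. fst (r x) i)" for i
      unfolding r_def by (cases "i \<le> n") (auto intro!: continuous_map_add continuous_map_coordinate)
    show "continuous_map (Simplex (n + Suc n)) euclideanreal (\<lambda>x. snd (r x))"
      unfolding r_def by (auto intro!: continuous_map_sum continuous_map_coordinate)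
    fix q assume "q \<in> topspace (Simplex (n + Suc n))"
    then have q: "\<And>i. 0 \<le> q i" "\<And>i. q i \<le> 1" "(\<Sum>i\<le>n + Suc n. q i) = 1"
      by (auto simp: standard_simplex_def)
    have sum: "(\<Sum>i\<le>n. q i) + (\<Sum>i\<le>n. q (i + Suc n)) = 1"
      using q(3) by (simp only: sum_atMost_split)
    have sum': "(\<Sum>i\<le>n. q i + q (i + Suc n)) = 1" using sum by (simp add: sum.distrib)
    have "q i + q (i + Suc n) \<le> 1" if "i \<le> n" for i
      using member_le_sum[of i "{..n}" "\<lambda>i. q i + q (i + Suc n)"] q that sum'
      by (simp add: add_nonneg_nonneg)
    then show "fst (r q) \<in> standard_simplex n"
      using q sum' by (auto simp: r_def standard_simplex_def)
    have "0 \<le> (\<Sum>i\<le>n. q i)" "0 \<le> (\<Sum>i\<le>n. q (i + Suc n))" using q by (auto intro: sum_nonneg)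
    then show "snd (r q) \<in> {0..1}" using sum by (auto simp: r_def)
  qed
  fix z assume "z \<in> topspace (prod_topology (Simplex n) unit_interval)"
  then have z: "fst z \<in> standard_simplex n" by auto
  have "fst (r (s z)) = fst z"
    using z by (auto simp: r_def s_def fun_eq_iff standard_simplex_def algebra_simps)
  moreover have "snd (r (s z)) = snd z"
    using z sum_s(1)[of z] by (auto simp: r_def standard_simplex_def)
  ultimately show "r (s z) = z" by (simp add: prod_eq_iff)
qed

text \<open>Local compactness of the interval is the reason: a point of \<open>U\<close> has a
  neighbourhood \<open>W \<times> ball\<close> in \<open>U\<close>, where \<open>W\<close> collects
  the points whose whole fibre over a compact interval around \<open>t\<close> lies in
  \<open>U\<close>. That \<open>W\<close> is open can be tested on simplices, hence on prisms, where
  the tube lemma applies.\<close>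

lemma delta_generated_cylinder:
  assumes X: "delta_generated X"
  shows "delta_generated (prod_topology X unit_interval)"
proof (rule delta_generatedI)
  fix U assume U: "delta_openin (prod_topology X unit_interval) U"
  define P where "P n \<sigma> = {z \<in> topspace (prod_topology (Simplex n) unit_interval). (\<sigma> (fst z), snd z) \<in> U}"
    for n and \<sigma> :: "(nat \<Rightarrow> real) \<Rightarrow> 'a"
  have P: "openin (prod_topology (Simplex n) unit_interval) (P n \<sigma>)"
    if \<sigma>: "continuous_map (Simplex n) X \<sigma>" for n \<sigma>
    unfolding P_def
  proof (rule delta_generatedD[OF delta_generated_prism], rule delta_openin_preimage[OF U])
    show "continuous_map (prod_topology (Simplex n) unit_interval) (prod_topology X unit_interval)
        (\<lambda>z. (\<sigma> (fst z), snd z))"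
      using continuous_map_compose[OF continuous_map_fst \<sigma>]
      by (simp add: continuous_map_pairwise o_def continuous_map_snd)
  qed
  show "openin (prod_topology X unit_interval) U"
  proof (subst openin_subopen, intro ballI)
    fix z assume z: "z \<in> U"
    obtain x t where xt: "z = (x, t)" by (cases z)
    have x: "x \<in> topspace X" and t: "t \<in> {0..1}" using U z xt by (auto simp: delta_openin_def)
    \<comment> \<open>The slice of \<open>U\<close> over \<open>x\<close> is open because it is also
      a slice of the prism over the constant 0-simplex at \<open>x\<close>.\<close>
    obtain e where e: "e \<in> standard_simplex 0" using nonempty_standard_simplex by blast
    have "openin unit_interval {u \<in> topspace unit_interval. (e, u) \<in> P 0 (\<lambda>_. x)}"
      by (rule openin_continuous_map_preimage[OF _ P])
         (use e x in \<open>auto simp: continuous_map_pairwise o_def\<close>)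
    moreover have "{u \<in> topspace unit_interval. (e, u) \<in> P 0 (\<lambda>_. x)} = {u \<in> {0..1}. (x, u) \<in> U}"
      using e by (auto simp: P_def)
    ultimately obtain T where T: "open T" "{u \<in> {0..1}. (x, u) \<in> U} = T \<inter> {0..1}"
      unfolding unit_interval_def by (auto simp: openin_subtopology)
    then have "t \<in> T" using z xt t by auto
    then obtain \<epsilon> where \<epsilon>: "\<epsilon> > 0" "cball t \<epsilon> \<subseteq> T" using T(1) by (auto simp: open_contains_cball)
    define C where "C = cball t \<epsilon> \<inter> {0..1}"
    have C: "compactin unit_interval C"
      by (simp add: C_def unit_interval_def compactin_subtopology compact_Int)
    \<comment> \<open>Closed under small perturbations along every simplex: if the fibre over
      \<open>p\<close> lies in the open set \<open>P n \<sigma>\<close>, compactness of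
      \<open>C\<close> gives a neighbourhood of \<open>p\<close> with the same property.\<close>
    define W where "W = {y \<in> topspace X. {y} \<times> C \<subseteq> U}"
    have "delta_openin X W"
      unfolding delta_openin_def
    proof (intro conjI allI impI)
      fix n and \<sigma> :: "(nat \<Rightarrow> real) \<Rightarrow> 'a" assume \<sigma>: "continuous_map (Simplex n) X \<sigma>"
      show "openin (Simplex n) {p \<in> standard_simplex n. \<sigma> p \<in> W}"
      proof (subst openin_subopen, intro ballI)
        fix p assume p: "p \<in> {p \<in> standard_simplex n. \<sigma> p \<in> W}"
        then have "{p} \<times> C \<subseteq> P n \<sigma>" by (auto simp: P_def W_def C_def)
        then obtain A B where AB: "openin (Simplex n) A" "p \<in> A" "C \<subseteq> B" "A \<times> B \<subseteq> P n \<sigma>"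
          using tube_lemma_right[OF P[OF \<sigma>] C, of p] p by auto
        have "A \<subseteq> {p \<in> standard_simplex n. \<sigma> p \<in> W}"
        proof
          fix q assume q: "q \<in> A"
          then have "q \<in> standard_simplex n" using openin_subset[OF AB(1)] by auto
          moreover have "{q} \<times> C \<subseteq> P n \<sigma>" using q AB(3,4) by blast
          ultimately show "q \<in> {p \<in> standard_simplex n. \<sigma> p \<in> W}"
            using \<sigma> by (auto simp: P_def W_def continuous_map_def)
        qed
        with AB show "\<exists>T. openin (Simplex n) T \<and> p \<in> T \<and> T \<subseteq> {p \<in> standard_simplex n. \<sigma> p \<in> W}"
          by blast
      qed
    qed (auto simp: W_def)
    then have W: "openin X W" by (rule delta_generatedD[OF X])
    have "openin unit_interval (ball t \<epsilon> \<inter> {0..1})"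
      unfolding unit_interval_def openin_subtopology by auto
    with W have "openin (prod_topology X unit_interval) (W \<times> (ball t \<epsilon> \<inter> {0..1}))"
      by (simp add: openin_prod_Times_iff)
    moreover have "z \<in> W \<times> (ball t \<epsilon> \<inter> {0..1})"
      using x t \<epsilon> T(2) by (auto simp: xt W_def C_def)
    moreover have "W \<times> (ball t \<epsilon> \<inter> {0..1}) \<subseteq> U"
    proof -
      have "ball t \<epsilon> \<inter> {0..1} \<subseteq> C" using ball_subset_cball by (auto simp: C_def)
      then show ?thesis by (fastforce simp: W_def)
    qed
    ultimately show "\<exists>T. openin (prod_topology X unit_interval) T \<and> z \<in> T \<and> T \<subseteq> U" by blast
  qed
qed

lemma delta_generated_Disc: "delta_generated (Disc n)"
proof (rule delta_generated_retract[OF delta_generated_Simplex])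
  \<comment> \<open>The disc is shrunk by \<open>N\<^sup>2\<close> and centred at the barycentre,
    whose \<open>n + 1\<close> coordinates are \<open>1 / N\<close>. The first \<open>n\<close>
    coordinates stay nonnegative since \<open>1 / N\<^sup>2 \<le> 1 / N\<close>, the last one since
    \<open>n * (1 / N + 1 / N\<^sup>2) = 1 - 1 / N\<^sup>2\<close>. The map \<open>y\<close> undoes
    this embedding.\<close>
  define N :: real where "N = real n + 1"
  have N: "N \<ge> 1" by (simp add: N_def)
  define y :: "(nat \<Rightarrow> real) \<Rightarrow> nat \<Rightarrow> real" where "y = (\<lambda>p i. (p i - 1 / N) * N\<^sup>2)"
  \<comment> \<open>Dividing by the squared norm instead of the norm avoids roots. It is harmless: a
    vector of squared norm at least 1 lands inside the disc, and on the disc itself \<open>m\<close>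
    is 1.\<close>
  define m where "m = (\<lambda>p. max 1 (\<Sum>i<n. (y p i)\<^sup>2))"
  define r where "r = (\<lambda>p i. if i < n then y p i / m p else 0)"
  define s :: "(nat \<Rightarrow> real) \<Rightarrow> nat \<Rightarrow> real" where
    "s = (\<lambda>x i. if i < n then 1 / N + x i / N\<^sup>2
                else if i = n then 1 - (\<Sum>j<n. 1 / N + x j / N\<^sup>2) else 0)"
  have m: "m p \<ge> 1" for p by (simp add: m_def)
  have Disc: "Disc n = subtopology (powertop_real UNIV) ({x. \<forall>i\<ge>n. x i = 0} \<inter> {x. (\<Sum>i<n. (x i)\<^sup>2) \<le> 1})"
    by (simp add: Disc_def Euclidean_space_def subtopology_subtopology)
  have ycont: "continuous_map (Simplex n) euclideanreal (\<lambda>p. y p i)" for i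
    unfolding y_def by (intro continuous_map_real_mult continuous_map_diff continuous_map_coordinate) auto
  show "continuous_map (Simplex n) (Disc n) r"
    unfolding Disc continuous_map_into_powertop_real
  proof (intro conjI allI funcsetI)
    have mcont: "continuous_map (Simplex n) euclideanreal m"
      unfolding m_def
      by (intro continuous_map_real_max continuous_map_sum continuous_map_real_pow ycont) auto
    show "continuous_map (Simplex n) euclideanreal (\<lambda>p. r p i)" for i
    proof (cases "i < n")
      case True
      have "m p \<noteq> 0" for p using m[of p] by linarith
      then show ?thesis
        using True by (auto simp: r_def intro!: continuous_map_real_divide ycont mcont)
    qed (simp add: r_def)
    fix p
    have "(\<Sum>i<n. (r p i)\<^sup>2) = (\<Sum>i<n. (y p i)\<^sup>2) / (m p)\<^sup>2"
      by (simp add: r_def power_divide sum_divide_distrib)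
    also have "\<dots> \<le> 1"
    proof -
      have "(\<Sum>i<n. (y p i)\<^sup>2) \<le> m p" by (simp add: m_def)
      also have "\<dots> \<le> (m p)\<^sup>2" using m[of p] by (simp add: power2_eq_square)
      finally show ?thesis using m[of p] by (simp add: divide_le_eq)
    qed
    finally show "r p \<in> {x. \<forall>i\<ge>n. x i = 0} \<inter> {x. (\<Sum>i<n. (x i)\<^sup>2) \<le> 1}" by (simp add: r_def)
  qed
  show "continuous_map (Disc n) (Simplex n) s"
    unfolding Disc continuous_map_into_powertop_real
  proof (intro conjI allI funcsetI)
    let ?D = "subtopology (powertop_real UNIV) ({x. \<forall>i\<ge>n. x i = 0} \<inter> {x. (\<Sum>i<n. (x i)\<^sup>2) \<le> (1::real)})"
    have c: "continuous_map ?D euclideanreal (\<lambda>x. 1 / N + x j / N\<^sup>2)" for j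
      using N by (intro continuous_map_add continuous_map_real_divide continuous_map_coordinate) auto
    show "continuous_map ?D euclideanreal (\<lambda>x. s x i)" for i
      unfolding s_def
      by (cases "i < n"; cases "i = n") (auto intro!: c continuous_map_diff continuous_map_sum)
    fix x assume "x \<in> topspace ?D"
    then have x: "(\<Sum>i<n. (x i)\<^sup>2) \<le> 1" by auto
    have abs: "\<bar>x i\<bar> \<le> 1" if "i < n" for i
    proof -
      have "(x i)\<^sup>2 \<le> (\<Sum>i<n. (x i)\<^sup>2)" using that by (intro member_le_sum) auto
      with x have "(x i)\<^sup>2 \<le> 1" by linarith
      then show ?thesis by (simp only: abs_square_le_1)
    qed
    have "x i \<le> N \<and> - x i \<le> N" if "i < n" for i using abs[OF that] N by linarith
    then have lo: "0 \<le> 1 / N + x i / N\<^sup>2" if "i < n" for i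
      using N that by (force simp: divide_simps power2_eq_square)
    have up: "1 / N + x i / N\<^sup>2 \<le> 1 / N + 1 / N\<^sup>2" if "i < n" for i
      using N abs[OF that] by (simp add: divide_right_mono)
    have "(\<Sum>j<n. 1 / N + x j / N\<^sup>2) \<le> n * (1 / N + 1 / N\<^sup>2)"
      using sum_bounded_above[of "{..<n}", OF up] by simp
    also have "\<dots> \<le> 1" using N by (simp add: divide_simps power2_eq_square N_def) (simp add: algebra_simps)
    finally have nonneg: "0 \<le> s x i" for i using lo by (simp add: s_def)
    have sum: "(\<Sum>i\<le>n. s x i) = 1"
      by (simp add: s_def flip: lessThan_Suc_atMost)
    have "s x i \<le> 1" for i
      using member_le_sum[of i "{..n}" "s x"] nonneg sum by (cases "i \<le> n") (auto simp: s_def)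
    then show "s x \<in> standard_simplex n"
      using nonneg sum by (auto simp: standard_simplex_def s_def)
  qed
  fix x assume "x \<in> topspace (Disc n)"
  then have x: "\<forall>i\<ge>n. x i = 0" "(\<Sum>i<n. (x i)\<^sup>2) \<le> 1" by (auto simp: Disc)
  have "y (s x) i = x i" if "i < n" for i using that N by (simp add: y_def s_def)
  then show "r (s x) = x"
    using x by (auto simp: r_def m_def fun_eq_iff)
qed

section \<open>Sizes, and copies of spaces inside the universe\<close>

lemma Times_lesspoll_UNIV:
  fixes A :: "'a set" and B :: "'b set"
  assumes A: "A \<prec> (UNIV :: 'u set)" and B: "B \<prec> (UNIV :: 'u set)" and inf: "infinite B"
  shows "A \<times> B \<prec> (UNIV :: 'u set)"
proof -
  note le = card_of_ordLeq[folded lepoll_def]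
  consider "|A| \<le>o |B|" | "|B| \<le>o |A|"
    using ordLeq_total[OF card_of_Well_order card_of_Well_order] by blast
  then show ?thesis
  proof cases
    case 1
    then have "|A \<times> B| \<le>o |B|"
      using inf by (intro card_of_Times_ordLeq_infinite) auto
    then show ?thesis using B lesspoll_trans1 unfolding le[symmetric] by blast
  next
    case 2
    then have "infinite A" using inf card_of_ordLeq_finite by blast
    then have "|A \<times> B| \<le>o |A|"
      using 2 by (intro card_of_Times_ordLeq_infinite) auto
    then show ?thesis using A lesspoll_trans1 unfolding le[symmetric] by blast
  qed
qed

text \<open>Transport of structure along an injection of the carrier into \<open>'u\<close>. It is
  what allows discs and cylinders, whose points have other types, to be used as objects of
  \<open>Top\<close>.\<close>

lemma Top_copy:
  fixes X :: "'a topology"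
  assumes X: "delta_generated X" and small: "topspace X \<prec> (UNIV :: 'u set)"
  shows "\<exists>Y\<in>(Top :: 'u topology set). X homeomorphic_space Y"
proof -
  obtain e :: "'a \<Rightarrow> 'u" where e: "inj_on e (topspace X)"
    using lesspoll_imp_lepoll[OF small] by (auto simp: lepoll_def)
  define d where "d = inv_into (topspace X) e"
  define Y where "Y = pullback_topology (e ` topspace X) d X"
  have de: "d (e x) = x" if "x \<in> topspace X" for x using e that by (simp add: d_def)
  have Y: "topspace Y = e ` topspace X"
    using de by (auto simp: Y_def topspace_pullback_topology)
  have d_cont: "continuous_map Y X d"
    using continuous_map_pullback[of X X id "e ` topspace X" d] by (simp add: Y_def)
  have e_cont: "continuous_map X Y e"
    unfolding Y_def
    by (rule continuous_map_pullback') (use de in \<open>auto intro: continuous_map_eq[OF continuous_map_id]\<close>)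
  have ed: "e (d y) = y" if "y \<in> topspace Y" for y using that de by (auto simp: Y)
  have "topspace Y \<prec> (UNIV :: 'u set)"
    using small e by (simp add: Y)
  then have "Y \<in> Top"
    using delta_generated_retract[OF X e_cont d_cont ed] by (simp add: Top_def)
  with e_cont d_cont de ed show ?thesis
    unfolding homeomorphic_space_def homeomorphic_maps_def by blast
qed

text \<open>A sequence of reals is determined by the Dedekind cuts of its terms.\<close>

lemma sequences_lepoll_reals: "(UNIV :: (nat \<Rightarrow> real) set) \<lesssim> (UNIV :: real set)"
proof -
  have "inj (\<lambda>x :: nat \<Rightarrow> real. {(i, q :: rat). of_rat q < x i})"
  proof (rule injI, rule ext, rule ccontr)
    fix x y :: "nat \<Rightarrow> real" and i
    assume eq: "{(i, q :: rat). of_rat q < x i} = {(i, q). of_rat q < y i}" and ne: "x i \<noteq> y i"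
    have *: "of_rat q < x i \<longleftrightarrow> of_rat q < y i" for q using eq by (auto simp: set_eq_iff)
    from ne consider "x i < y i" | "y i < x i" by linarith
    then show False
    proof cases
      case 1 then obtain q where "x i < of_rat q" "of_rat q < y i" using of_rat_dense by blast
      then show False using *[of q] by simp
    next
      case 2 then obtain q where "y i < of_rat q" "of_rat q < x i" using of_rat_dense by blast
      then show False using *[of q] by simp
    qed
  qed
  then have "(UNIV :: (nat \<Rightarrow> real) set) \<lesssim> (UNIV :: (nat \<times> rat) set set)"
    by (auto simp: lepoll_def)
  also have "(UNIV :: (nat \<times> rat) set set) \<lesssim> (UNIV :: nat set set)"
    using inj_image_eq_iff[OF inj_to_nat] by (metis lepoll_def injI subset_UNIV)
  also have "(UNIV :: nat set set) \<approx> (UNIV :: real set)" by (rule nat_sets_eqpoll_reals)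
  finally show ?thesis .
qed

section \<open>Fibrations\<close>

text \<open>A lifting problem over \<open>Z\<close> is pulled back to \<open>Z'\<close> along
  \<open>r\<close>, and the lift is restricted along \<open>s\<close>. In particular lifting may be
  tested on a homeomorphic copy.\<close>

lemma homotopy_lifting_retract:
  assumes r: "continuous_map Z' Z r" and s: "continuous_map Z Z' s"
    and rs: "\<And>z. z \<in> topspace Z \<Longrightarrow> r (s z) = z" and lift: "homotopy_lifting Z' E B p"
  shows "homotopy_lifting Z E B p"
  unfolding homotopy_lifting_def
proof (intro allI impI)
  fix g h
  let ?C = "prod_topology Z unit_interval" and ?C' = "prod_topology Z' unit_interval"
  assume g: "continuous_map (subtopology ?C (topspace Z \<times> {0})) E g"
    and h: "continuous_map ?C B h" and gh: "\<forall>w\<in>topspace Z \<times> {0}. p (g w) = h w"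
  define R where "R = (\<lambda>w :: _ \<times> real. (r (fst w), snd w))"
  define S where "S = (\<lambda>w :: _ \<times> real. (s (fst w), snd w))"
  have R: "continuous_map ?C' ?C R"
    using continuous_map_compose[OF continuous_map_fst r]
    by (simp add: R_def continuous_map_pairwise o_def continuous_map_snd)
  have S: "continuous_map ?C ?C' S"
    using continuous_map_compose[OF continuous_map_fst s]
    by (simp add: S_def continuous_map_pairwise o_def continuous_map_snd)
  have rZ: "r z \<in> topspace Z" if "z \<in> topspace Z'" for z using r that by (auto simp: continuous_map_def)
  have sZ: "s z \<in> topspace Z'" if "z \<in> topspace Z" for z using s that by (auto simp: continuous_map_def)
  have "continuous_map (subtopology ?C' (topspace Z' \<times> {0})) (subtopology ?C (topspace Z \<times> {0})) R"
    using R rZ by (auto simp: continuous_map_in_subtopology continuous_map_from_subtopology R_def)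
  then have "continuous_map (subtopology ?C' (topspace Z' \<times> {0})) E (g \<circ> R)"
    using g by (rule continuous_map_compose)
  moreover have "continuous_map ?C' B (h \<circ> R)" using R h by (rule continuous_map_compose)
  moreover have "\<forall>w\<in>topspace Z' \<times> {0}. p ((g \<circ> R) w) = (h \<circ> R) w"
    using gh rZ by (auto simp: R_def)
  ultimately obtain l where l: "continuous_map ?C' E l"
    "\<forall>w\<in>topspace Z' \<times> {0}. l w = (g \<circ> R) w" "\<forall>w\<in>topspace Z' \<times> {0..1}. p (l w) = (h \<circ> R) w"
    using lift unfolding homotopy_lifting_def by blast
  have RS: "R (S w) = w" if "w \<in> topspace Z \<times> UNIV" for w using that rs by (auto simp: R_def S_def)
  show "\<exists>l. continuous_map ?C E l \<and> (\<forall>w\<in>topspace Z \<times> {0}. l w = g w) \<and>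
          (\<forall>w\<in>topspace Z \<times> {0..1}. p (l w) = h w)"
  proof (intro exI[of _ "l \<circ> S"] conjI ballI)
    show "continuous_map ?C E (l \<circ> S)" using S l(1) by (rule continuous_map_compose)
  next
    fix w assume w: "w \<in> topspace Z \<times> {0::real}"
    then have "S w \<in> topspace Z' \<times> {0}" using sZ by (auto simp: S_def)
    then show "(l \<circ> S) w = g w" using l(2) RS[of w] w by auto
  next
    fix w assume w: "w \<in> topspace Z \<times> {0..1::real}"
    then have "S w \<in> topspace Z' \<times> {0..1}" using sZ by (auto simp: S_def)
    then show "p ((l \<circ> S) w) = h w" using l(3) RS[of w] w by auto
  qed
qed

lemma h_fibration_homotopy_lifting:
  fixes E B :: "'u topology"
  assumes p: "h_fibration E B p" and Z: "delta_generated Z" "topspace Z \<prec> (UNIV :: 'u set)"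
  shows "homotopy_lifting Z E B p"
proof -
  obtain Y :: "'u topology" and e d where Y: "Y \<in> Top" and ed: "homeomorphic_maps Z Y e d"
    using Top_copy[OF Z] by (auto simp: homeomorphic_space_def)
  have "homotopy_lifting Y E B p" using p Y by (simp add: h_fibration_def)
  with ed show ?thesis
    unfolding homeomorphic_maps_def by (blast intro: homotopy_lifting_retract)
qed

text \<open>A disc has at most as many points as there are reals, so it has a copy in
  \<open>Top\<close>, against which an h-fibration lifts by definition.\<close>

lemma h_fibration_imp_q_fibration:
  fixes E B :: "'u topology"
  assumes "(UNIV :: real set) \<prec> (UNIV :: 'u set)" and p: "h_fibration E B p"
  shows "q_fibration E B p"
proof -
  have "topspace (Disc n) \<prec> (UNIV :: 'u set)" for n
    using lesspoll_trans1[OF lepoll_trans[OF subset_imp_lepoll[OF subset_UNIV] sequences_lepoll_reals]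
        assms(1)] .
  then have "homotopy_lifting (Disc n) E B p" for n
    by (rule h_fibration_homotopy_lifting[OF p delta_generated_Disc])
  moreover have "continuous_map E B p" using p unfolding h_fibration_def by blast
  ultimately show ?thesis by (simp add: q_fibration_def)
qed

section \<open>Weak homotopy equivalences\<close>

lemma based_homotopy_refl: "\<alpha> \<in> based_cubes n X x \<Longrightarrow> (\<alpha>, \<alpha>) \<in> based_homotopy n X x"
  by (auto simp: based_homotopy_def based_cubes_def)

lemma based_homotopy_sym: "(\<alpha>, \<beta>) \<in> based_homotopy n X x \<Longrightarrow> (\<beta>, \<alpha>) \<in> based_homotopy n X x"
  by (simp add: based_homotopy_def homotopic_with_sym)

lemma based_homotopy_trans:
  "(\<alpha>, \<beta>) \<in> based_homotopy n X x \<Longrightarrow> (\<beta>, \<gamma>) \<in> based_homotopy n X x \<Longrightarrow> (\<alpha>, \<gamma>) \<in> based_homotopy n X x"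
  unfolding based_homotopy_def using homotopic_with_trans by fast

lemma equiv_based_homotopy: "equiv (based_cubes n X x) (based_homotopy n X x)"
proof (rule equivI)
  show "based_homotopy n X x \<subseteq> based_cubes n X x \<times> based_cubes n X x"
    by (auto simp: based_homotopy_def)
  show "refl_on (based_cubes n X x) (based_homotopy n X x)"
    by (intro refl_onI based_homotopy_refl)
  show "sym (based_homotopy n X x)" by (rule symI) (rule based_homotopy_sym)
  show "trans (based_homotopy n X x)" by (rule transI) (rule based_homotopy_trans)
qed

lemma based_cubes_compose:
  assumes "\<alpha> \<in> based_cubes n X x" "continuous_map X Y f"
  shows "f \<circ> \<alpha> \<in> based_cubes n Y (f x)"
  using assms continuous_map_compose[of "Cube n" X \<alpha> Y f] by (simp add: based_cubes_def)

lemma based_homotopy_compose: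
  assumes "(\<alpha>, \<beta>) \<in> based_homotopy n X x" "continuous_map X Y f"
  shows "(f \<circ> \<alpha>, f \<circ> \<beta>) \<in> based_homotopy n Y (f x)"
proof -
  have "homotopic_with (\<lambda>\<gamma>. \<forall>p\<in>cube_boundary n. \<gamma> p = f x) (Cube n) Y (f \<circ> \<alpha>) (f \<circ> \<beta>)"
  proof (rule homotopic_with_compose_continuous_map_left[OF _ assms(2)])
    show "homotopic_with (\<lambda>\<gamma>. \<forall>p\<in>cube_boundary n. \<gamma> p = x) (Cube n) X \<alpha> \<beta>"
      using assms(1) by (simp add: based_homotopy_def)
  qed simp
  then show ?thesis
    using assms based_cubes_compose[OF _ assms(2)] by (simp add: based_homotopy_def)
qed

text \<open>Composition with \<open>f\<close> preserves based homotopy, so all images of a class lie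
  in one class. Functoriality can then be checked on representatives.\<close>

lemma homotopy_group_map_class:
  assumes f: "continuous_map X Y f" and \<alpha>: "\<alpha> \<in> based_cubes n X x"
  shows "homotopy_group_map n Y (f x) f (based_homotopy n X x `` {\<alpha>}) = based_homotopy n Y (f x) `` {f \<circ> \<alpha>}"
  unfolding homotopy_group_map_def
proof (intro equalityI subsetI)
  fix \<gamma> assume "\<gamma> \<in> based_homotopy n Y (f x) `` (\<circ>) f ` (based_homotopy n X x `` {\<alpha>})"
  then obtain \<beta> where "(\<alpha>, \<beta>) \<in> based_homotopy n X x" "(f \<circ> \<beta>, \<gamma>) \<in> based_homotopy n Y (f x)"
    by blast
  then show "\<gamma> \<in> based_homotopy n Y (f x) `` {f \<circ> \<alpha>}"
    using based_homotopy_trans[OF based_homotopy_compose[OF _ f]] by blast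
qed (use based_homotopy_refl[OF \<alpha>] in blast)

lemma homotopy_group_map_in:
  assumes "continuous_map X Y f" "c \<in> homotopy_group n X x"
  shows "homotopy_group_map n Y (f x) f c \<in> homotopy_group n Y (f x)"
proof -
  obtain \<alpha> where "\<alpha> \<in> based_cubes n X x" "c = based_homotopy n X x `` {\<alpha>}"
    using assms(2) by (auto simp: homotopy_group_def elim: quotientE)
  then show ?thesis
    using quotientI[OF based_cubes_compose[OF _ assms(1)]]
    by (simp add: homotopy_group_def homotopy_group_map_class[OF assms(1)])
qed

lemma homotopy_group_map_comp:
  assumes f: "continuous_map X Y f" and g: "continuous_map Y Z g" and c: "c \<in> homotopy_group n X x"
  shows "homotopy_group_map n Z ((g \<circ> f) x) (g \<circ> f) c
       = homotopy_group_map n Z (g (f x)) g (homotopy_group_map n Y (f x) f c)"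
proof -
  obtain \<alpha> where \<alpha>: "\<alpha> \<in> based_cubes n X x" "c = based_homotopy n X x `` {\<alpha>}"
    using c by (auto simp: homotopy_group_def elim: quotientE)
  show ?thesis
    using homotopy_group_map_class[OF continuous_map_compose[OF f g] \<alpha>(1)]
      homotopy_group_map_class[OF f \<alpha>(1)] homotopy_group_map_class[OF g based_cubes_compose[OF \<alpha>(1) f]]
    by (simp add: \<alpha>(2) o_assoc)
qed

lemma homotopy_group_map_cong:
  assumes f: "continuous_map X Y f" and eq: "\<And>z. z \<in> topspace X \<Longrightarrow> f z = g z"
    and x: "x \<in> topspace X" and c: "c \<in> homotopy_group n X x"
  shows "homotopy_group_map n Y (f x) f c = homotopy_group_map n Y (g x) g c"
proof -
  obtain \<alpha> where \<alpha>: "\<alpha> \<in> based_cubes n X x" "c = based_homotopy n X x `` {\<alpha>}"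
    using c by (auto simp: homotopy_group_def elim: quotientE)
  have g: "continuous_map X Y g" using f eq by (rule continuous_map_eq)
  have "(f \<circ> \<alpha>, g \<circ> \<alpha>) \<in> based_homotopy n Y (f x)"
  proof -
    have f\<alpha>: "f \<circ> \<alpha> \<in> based_cubes n Y (f x)" and g\<alpha>: "g \<circ> \<alpha> \<in> based_cubes n Y (f x)"
      using based_cubes_compose[OF \<alpha>(1) f] based_cubes_compose[OF \<alpha>(1) g] eq[OF x] by simp_all
    moreover have "homotopic_with (\<lambda>\<gamma>. \<forall>p\<in>cube_boundary n. \<gamma> p = f x) (Cube n) Y (f \<circ> \<alpha>) (g \<circ> \<alpha>)"
      using f\<alpha> g\<alpha> eq \<alpha>(1)
      by (intro homotopic_with_equal) (simp_all add: based_cubes_def continuous_map_def Pi_iff)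
    ultimately show ?thesis by (simp add: based_homotopy_def)
  qed
  then have "based_homotopy n Y (f x) `` {f \<circ> \<alpha>} = based_homotopy n Y (g x) `` {g \<circ> \<alpha>}"
    using equiv_class_eq[OF equiv_based_homotopy] eq[OF x] by fastforce
  then show ?thesis
    by (simp add: \<alpha>(2) homotopy_group_map_class[OF f \<alpha>(1)] homotopy_group_map_class[OF g \<alpha>(1)])
qed

section \<open>Path components\<close>

abbreviation path_components_map :: "'b topology \<Rightarrow> ('a \<Rightarrow> 'b) \<Rightarrow> 'a set \<Rightarrow> 'b set" where
  "path_components_map Y f \<equiv> \<lambda>c. {y. \<exists>x\<in>c. path_component_of Y (f x) y}"

lemma path_component_of_image:
  assumes "path_component_of X x y" "continuous_map X Y f"
  shows "path_component_of Y (f x) (f y)"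
proof -
  obtain g where "pathin X g" "g 0 = x" "g 1 = y" using assms(1) by (auto simp: path_component_of_def)
  then show ?thesis
    using continuous_map_compose[of _ X g Y f, OF _ assms(2)] unfolding path_component_of_def pathin_def
    by (intro exI[of _ "f \<circ> g"]) simp
qed

lemma path_components_map_class:
  assumes f: "continuous_map X Y f" and x: "x \<in> topspace X"
  shows "path_components_map Y f (path_component_of_set X x) = path_component_of_set Y (f x)"
proof -
  have "path_component_of X x x" using x by (simp add: path_component_of_refl)
  moreover have "path_component_of Y (f x) y"
    if "path_component_of X x z" "path_component_of Y (f z) y" for y z
    using path_component_of_trans[OF path_component_of_image[OF that(1) f] that(2)] .
  ultimately show ?thesis by blast
qed

lemma path_components_map_in:
  assumes "continuous_map X Y f" "c \<in> path_components_of X"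
  shows "path_components_map Y f c \<in> path_components_of Y"
proof -
  obtain x where x: "x \<in> topspace X" "c = path_component_of_set X x"
    using assms(2) by (auto simp: path_components_of_def)
  moreover have "f x \<in> topspace Y" using x(1) assms(1) by (auto simp: continuous_map_def)
  ultimately show ?thesis
    unfolding path_components_of_def using path_components_map_class[OF assms(1) x(1)] by simp
qed

lemma path_components_map_comp:
  assumes f: "continuous_map X Y f" and g: "continuous_map Y Z g" and c: "c \<in> path_components_of X"
  shows "path_components_map Z (g \<circ> f) c = path_components_map Z g (path_components_map Y f c)"
proof -
  obtain x where x: "x \<in> topspace X" "c = path_component_of_set X x"
    using c by (auto simp: path_components_of_def)
  moreover have "f x \<in> topspace Y" using x(1) f by (auto simp: continuous_map_def)
  ultimately show ?thesis
    using path_components_map_class[OF continuous_map_compose[OF f g] x(1)]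
      path_components_map_class[OF f x(1)] path_components_map_class[OF g, of "f x"]
    by (simp only: o_apply)
qed

text \<open>Injectivity of \<open>u\<close> comes from that of the composite with \<open>v\<close>.
  For surjectivity, \<open>v b = v (u a)\<close> for some \<open>a\<close>, and \<open>v\<close> is
  injective on \<open>B\<close> because its composite with \<open>w\<close> is.\<close>

lemma bij_betw_two_out_of_six:
  assumes u: "u \<in> A \<rightarrow> B" and v: "v \<in> B \<rightarrow> C"
    and vu: "bij_betw (\<lambda>a. v (u a)) A C" and wv: "bij_betw (\<lambda>b. w (v b)) B D"
  shows "bij_betw u A B"
proof -
  have "inj_on u A"
    using inj_on_imageI2[of v u A] bij_betw_imp_inj_on[OF vu] by (simp add: comp_def)
  moreover have "b \<in> u ` A" if b: "b \<in> B" for b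
  proof -
    have "v b \<in> (\<lambda>a. v (u a)) ` A" using v b bij_betw_imp_surj_on[OF vu] by blast
    then obtain a where a: "a \<in> A" "v b = v (u a)" by blast
    then have "b = u a" using inj_onD[OF bij_betw_imp_inj_on[OF wv], of b "u a"] u b by auto
    then show ?thesis using a by blast
  qed
  then have "u ` A = B" using u by blast
  ultimately show ?thesis by (simp add: bij_betw_def)
qed

text \<open>
  In contrast to two-out-of-three, this form holds base point by base point: only base points in the
  images of the given maps occur.
\<close>

lemma weak_homotopy_equivalence_two_out_of_six:
  assumes f: "continuous_map X Y f" and g: "continuous_map Y Z g" and h: "continuous_map Z W h"
    and gf: "weak_homotopy_equivalence X Z (g \<circ> f)" and hg: "weak_homotopy_equivalence Y W (h \<circ> g)"
  shows "weak_homotopy_equivalence X Y f"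
  unfolding weak_homotopy_equivalence_def
proof (intro conjI allI impI ballI)
  have "bij_betw (\<lambda>c. path_components_map Z g (path_components_map Y f c))
      (path_components_of X) (path_components_of Z)"
    using gf path_components_map_comp[OF f g]
    unfolding weak_homotopy_equivalence_def by (simp cong: bij_betw_cong)
  moreover have "bij_betw (\<lambda>c. path_components_map W h (path_components_map Z g c))
      (path_components_of Y) (path_components_of W)"
    using hg path_components_map_comp[OF g h]
    unfolding weak_homotopy_equivalence_def by (simp cong: bij_betw_cong)
  ultimately show "bij_betw (path_components_map Y f) (path_components_of X) (path_components_of Y)"
    using path_components_map_in[OF f] path_components_map_in[OF g]
    by (intro bij_betw_two_out_of_six[where v = "path_components_map Z g" and w = "path_components_map W h"]) auto
next
  fix n :: nat and x assume n: "n \<ge> 1" and x: "x \<in> topspace X"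
  then have fx: "f x \<in> topspace Y" using f by (auto simp: continuous_map_def)
  have "bij_betw (\<lambda>c. homotopy_group_map n Z (g (f x)) g (homotopy_group_map n Y (f x) f c))
      (homotopy_group n X x) (homotopy_group n Z (g (f x)))"
  proof (rule iffD1[OF bij_betw_cong])
    show "bij_betw (homotopy_group_map n Z ((g \<circ> f) x) (g \<circ> f))
        (homotopy_group n X x) (homotopy_group n Z (g (f x)))"
      using gf n x by (auto simp: weak_homotopy_equivalence_def)
  qed (rule homotopy_group_map_comp[OF f g])
  moreover have "bij_betw (\<lambda>c. homotopy_group_map n W (h (g (f x))) h (homotopy_group_map n Z (g (f x)) g c))
      (homotopy_group n Y (f x)) (homotopy_group n W (h (g (f x))))"
  proof (rule iffD1[OF bij_betw_cong])
    show "bij_betw (homotopy_group_map n W ((h \<circ> g) (f x)) (h \<circ> g))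
        (homotopy_group n Y (f x)) (homotopy_group n W (h (g (f x))))"
      using hg n fx by (auto simp: weak_homotopy_equivalence_def)
  qed (rule homotopy_group_map_comp[OF g h])
  ultimately show "bij_betw (homotopy_group_map n Y (f x) f) (homotopy_group n X x) (homotopy_group n Y (f x))"
    using homotopy_group_map_in[OF f] homotopy_group_map_in[OF g]
    by (intro bij_betw_two_out_of_six[where v = "homotopy_group_map n Z (g (f x)) g"
          and w = "homotopy_group_map n W (h (g (f x))) h"]) auto
qed (rule f)

text \<open>Maps of flows are \<open>undefined\<close> off their domains, and the composites on
  cylinders below agree with the intended maps only on the points of the space. Values elsewhere
  must therefore not matter.\<close>

lemma weak_homotopy_equivalence_cong:
  assumes f: "weak_homotopy_equivalence X Y f" and eq: "\<And>x. x \<in> topspace X \<Longrightarrow> f x = g x"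
  shows "weak_homotopy_equivalence X Y g"
proof -
  have fc: "continuous_map X Y f" using f by (simp add: weak_homotopy_equivalence_def)
  have "path_components_map Y f c = path_components_map Y g c" if "c \<in> path_components_of X" for c
    using path_components_of_subset[OF that] by (intro Collect_cong bex_cong) (auto simp: eq)
  then have "bij_betw (path_components_map Y g) (path_components_of X) (path_components_of Y)"
    using f unfolding weak_homotopy_equivalence_def by (simp cong: bij_betw_cong)
  moreover have "bij_betw (homotopy_group_map n Y (g x) g) (homotopy_group n X x) (homotopy_group n Y (g x))"
    if "n \<ge> 1" "x \<in> topspace X" for n x
  proof (rule iffD1[OF bij_betw_cong])
    show "bij_betw (homotopy_group_map n Y (f x) f) (homotopy_group n X x) (homotopy_group n Y (g x))"
    proof -
      have "bij_betw (homotopy_group_map n Y (f x) f) (homotopy_group n X x) (homotopy_group n Y (f x))"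
        using f that unfolding weak_homotopy_equivalence_def by blast
      then show ?thesis using eq[OF that(2)] by simp
    qed
  qed (rule homotopy_group_map_cong[OF fc eq that(2)])
  moreover have "continuous_map X Y g" using fc eq by (rule continuous_map_eq)
  ultimately show ?thesis by (simp add: weak_homotopy_equivalence_def)
qed

section \<open>Globes\<close>

text \<open>
  The globe of a space \<open>Z\<close>: no two paths are composable since \<open>a \<noteq> b\<close>. Thereby properties of maps
  of flows specialize to properties of maps of spaces.
\<close>

definition glob :: "'u \<Rightarrow> 'u \<Rightarrow> 'u topology \<Rightarrow> 'u flow" where
  "glob a b Z = \<lparr>states = {a, b}, paths = Z, src = (\<lambda>x\<in>topspace Z. a), tgt = (\<lambda>x\<in>topspace Z. b),
     pconcat = (\<lambda>_. undefined)\<rparr>"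

definition glob_map :: "'u \<Rightarrow> 'u \<Rightarrow> 'u topology \<Rightarrow> 'u topology \<Rightarrow> ('u \<Rightarrow> 'u) \<Rightarrow> 'u flow_map" where
  "glob_map a b Z W f = \<lparr>dom_flow = glob a b Z, cod_flow = glob a b W,
     on_states = restrict id {a, b}, on_paths = restrict f (topspace Z)\<rparr>"

lemma glob_simps [simp]:
  "states (glob a b Z) = {a, b}" "paths (glob a b Z) = Z"
  "src (glob a b Z) = (\<lambda>x\<in>topspace Z. a)" "tgt (glob a b Z) = (\<lambda>x\<in>topspace Z. b)"
  "pconcat (glob a b Z) = (\<lambda>_. undefined)"
  by (simp_all add: glob_def)

lemma glob_map_simps [simp]:
  "dom_flow (glob_map a b Z W f) = glob a b Z" "cod_flow (glob_map a b Z W f) = glob a b W"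
  "on_states (glob_map a b Z W f) = restrict id {a, b}"
  "on_paths (glob_map a b Z W f) = restrict f (topspace Z)"
  by (simp_all add: glob_map_def)

lemma Flow_simps [simp]:
  "Obj Flow = {X. is_flow X}" "Arr Flow = {f. is_flow_map f}" "Dom Flow = dom_flow" "Cod Flow = cod_flow"
  by (simp_all add: Flow_def)

lemma arrows_Flow: "f \<in> arrows Flow X Y \<longleftrightarrow> is_flow_map f \<and> dom_flow f = X \<and> cod_flow f = Y"
  by (simp add: arrows_def)

lemma Cmp_Flow_simps [simp]:
  "dom_flow (Cmp Flow g f) = dom_flow f" "cod_flow (Cmp Flow g f) = cod_flow g"
  "on_states (Cmp Flow g f) = compose (states (dom_flow f)) (on_states g) (on_states f)"
  "on_paths (Cmp Flow g f) = compose (topspace (paths (dom_flow f))) (on_paths g) (on_paths f)"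
  by (simp_all add: Flow_def)

lemma is_flow_map_dest:
  assumes "is_flow_map f"
  shows "is_flow (dom_flow f)" "is_flow (cod_flow f)"
    "on_states f \<in> states (dom_flow f) \<rightarrow>\<^sub>E states (cod_flow f)"
    "on_paths f \<in> extensional (topspace (paths (dom_flow f)))"
    "continuous_map (paths (dom_flow f)) (paths (cod_flow f)) (on_paths f)"
    "\<And>x. x \<in> topspace (paths (dom_flow f)) \<Longrightarrow> src (cod_flow f) (on_paths f x) = on_states f (src (dom_flow f) x)"
    "\<And>x. x \<in> topspace (paths (dom_flow f)) \<Longrightarrow> tgt (cod_flow f) (on_paths f x) = on_states f (tgt (dom_flow f) x)"
  using assms by (simp_all add: is_flow_map_def Let_def)

lemma is_flow_glob:
  fixes Z :: "'u topology"
  assumes ab: "a \<noteq> b" and Z: "Z \<in> Top" and inf: "infinite (UNIV :: 'u set)"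
  shows "is_flow (glob a b Z)"
proof -
  have "topspace (composable_paths (glob a b Z)) = {}"
    using ab by (auto simp: topspace_composable_paths)
  moreover have "{a, b} \<prec> (UNIV :: 'u set)"
    using inf by (intro finite_lesspoll_infinite) auto
  moreover have "continuous_map Z (discrete_topology {a, b}) (\<lambda>x\<in>topspace Z. c)" if "c \<in> {a, b}" for c
    using that by (intro continuous_map_eq[OF continuous_map_const[THEN iffD2]]) auto
  ultimately show ?thesis
    using ab Z by (auto simp: is_flow_def continuous_map_on_empty)
qed

lemma is_flow_map_glob_map:
  fixes Z W :: "'u topology"
  assumes ab: "a \<noteq> b" and Z: "Z \<in> Top" and W: "W \<in> Top" and inf: "infinite (UNIV :: 'u set)"
    and f: "continuous_map Z W f"
  shows "is_flow_map (glob_map a b Z W f)"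
proof -
  have "continuous_map Z W (restrict f (topspace Z))"
    using f by (rule continuous_map_eq) simp
  moreover have "f x \<in> topspace W" if "x \<in> topspace Z" for x
    using f that by (auto simp: continuous_map_def)
  ultimately show ?thesis
    using is_flow_glob[OF ab Z inf] is_flow_glob[OF ab W inf] ab
    by (simp add: is_flow_map_def Let_def)
qed

lemma Cmp_glob_map:
  assumes f: "continuous_map Z W f"
  shows "Cmp Flow (glob_map a b W V g) (glob_map a b Z W f) = glob_map a b Z V (g \<circ> f)"
proof -
  have "f x \<in> topspace W" if "x \<in> topspace Z" for x
    using f that by (auto simp: continuous_map_def)
  then show ?thesis
    by (intro flow_map.equality) (auto simp: compose_def fun_eq_iff)
qed

text \<open>Disposes of the path spaces of a globe other than the one from \<open>a\<close> to
  \<open>b\<close>.\<close>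

lemma weak_homotopy_equivalence_empty:
  assumes "topspace X = {}" "topspace Y = {}"
  shows "weak_homotopy_equivalence X Y f"
  using assms by (simp add: weak_homotopy_equivalence_def path_components_of_def bij_betw_def continuous_map_on_empty)

lemma topspace_path_space:
  "topspace (path_space X a b) = {x \<in> topspace (paths X). src X x = a \<and> tgt X x = b}"
  by (auto simp: path_space_def)

lemma continuous_map_path_space:
  "continuous_map Z (path_space X a b) f \<longleftrightarrow>
     continuous_map Z (paths X) f \<and> (\<forall>z\<in>topspace Z. src X (f z) = a \<and> tgt X (f z) = b)"
  unfolding path_space_def continuous_map_in_subtopology
  using continuous_map_funspace[of Z "paths X" f] by blast

lemma path_space_glob: "path_space (glob a b Z) a b = Z"
proof -
  have "{x \<in> topspace Z. src (glob a b Z) x = a \<and> tgt (glob a b Z) x = b} = topspace Z"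
    by auto
  then show ?thesis by (simp add: path_space_def subtopology_topspace del: glob_simps(3,4))
qed

lemma path_space_glob_empty: "(c, d) \<noteq> (a, b) \<Longrightarrow> topspace (path_space (glob a b Z) c d) = {}"
  by (auto simp: topspace_path_space)

lemma locally_weak_homotopy_equivalence_glob_map:
  assumes ab: "a \<noteq> b"
  shows "locally_in weak_homotopy_equivalence (glob_map a b Z W f) \<longleftrightarrow> weak_homotopy_equivalence Z W f"
proof -
  have "weak_homotopy_equivalence (path_space (glob a b Z) c d) (path_space (glob a b W) c d) (restrict f (topspace Z))"
    if "(c, d) \<noteq> (a, b)" for c d
    using path_space_glob_empty[OF that] by (intro weak_homotopy_equivalence_empty)
  moreover have "weak_homotopy_equivalence Z W (restrict f (topspace Z)) \<longleftrightarrow> weak_homotopy_equivalence Z W f"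
    by (auto elim!: weak_homotopy_equivalence_cong)
  ultimately show ?thesis
    using ab by (auto simp: locally_in_def path_space_glob)
qed

text \<open>A map from a globe to a flow amounts to two states and a map of spaces into the path
  space between them, compatibility with composition being vacuous. A square against
  \<open>p\<close> is thus a square of spaces over one pair of states.\<close>

lemma has_lifting_glob_map:
  fixes Z W :: "'u topology"
  assumes ab: "a \<noteq> b" and Z: "Z \<in> Top" and W: "W \<in> Top" and inf: "infinite (UNIV :: 'u set)"
    and i: "continuous_map Z W i" and p: "is_flow_map p"
    and lift: "\<And>\<alpha> \<beta> g h. \<lbrakk>\<alpha> \<in> states (dom_flow p); \<beta> \<in> states (dom_flow p);
        continuous_map Z (path_space (dom_flow p) \<alpha> \<beta>) g;
        continuous_map W (path_space (cod_flow p) (on_states p \<alpha>) (on_states p \<beta>)) h;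
        \<And>x. x \<in> topspace Z \<Longrightarrow> on_paths p (g x) = h (i x)\<rbrakk> \<Longrightarrow>
        \<exists>l. continuous_map W (path_space (dom_flow p) \<alpha> \<beta>) l \<and>
          (\<forall>x\<in>topspace Z. l (i x) = g x) \<and> (\<forall>y\<in>topspace W. on_paths p (l y) = h y)"
  shows "has_lifting Flow (glob_map a b Z W i) p"
  unfolding has_lifting_def arrows_Flow Flow_simps glob_map_simps Ball_def Bex_def
proof (intro allI impI, elim conjE)
  fix u v
  assume u: "is_flow_map u" "dom_flow u = glob a b Z" "cod_flow u = dom_flow p"
    and v: "is_flow_map v" "dom_flow v = glob a b W" "cod_flow v = cod_flow p"
    and square: "Cmp Flow p u = Cmp Flow v (glob_map a b Z W i)"
  note p' = is_flow_map_dest[OF p] and u' = is_flow_map_dest[OF u(1), unfolded u(2,3) glob_simps]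
    and v' = is_flow_map_dest[OF v(1), unfolded v(2,3) glob_simps]
  have iW: "i x \<in> topspace W" if "x \<in> topspace Z" for x using i that by (auto simp: continuous_map_def)
  have states_eq: "on_states p (on_states u c) = on_states v c" if "c \<in> {a, b}" for c
    using fun_cong[OF arg_cong[OF square, of on_states], of c] that by (auto simp: u(2) compose_def)
  have paths_eq: "on_paths p (on_paths u x) = on_paths v (i x)" if "x \<in> topspace Z" for x
    using fun_cong[OF arg_cong[OF square, of on_paths], of x] that by (auto simp: u(2) compose_def)
  define \<alpha> \<beta> where "\<alpha> = on_states u a" and "\<beta> = on_states u b"
  have "continuous_map Z (path_space (dom_flow p) \<alpha> \<beta>) (on_paths u)"
    using u'(5-7) by (simp add: continuous_map_path_space \<alpha>_def \<beta>_def)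
  moreover have "continuous_map W (path_space (cod_flow p) (on_states p \<alpha>) (on_states p \<beta>)) (on_paths v)"
    using v'(5-7) by (simp add: continuous_map_path_space \<alpha>_def \<beta>_def states_eq)
  moreover have "\<alpha> \<in> states (dom_flow p)" "\<beta> \<in> states (dom_flow p)"
    using u'(3) by (auto simp: \<alpha>_def \<beta>_def)
  ultimately obtain k where k: "continuous_map W (path_space (dom_flow p) \<alpha> \<beta>) k"
    "\<forall>x\<in>topspace Z. k (i x) = on_paths u x" "\<forall>y\<in>topspace W. on_paths p (k y) = on_paths v y"
    using lift[of \<alpha> \<beta> "on_paths u" "on_paths v"] paths_eq by blast
  \<comment> \<open>The states are forced: \<open>glob_map\<close> is the identity on them, so the
    lift must agree with \<open>u\<close> there.\<close>
  define l where "l = \<lparr>dom_flow = glob a b W, cod_flow = dom_flow p,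
    on_states = on_states u, on_paths = restrict k (topspace W)\<rparr>"
  have k_cont: "continuous_map W (paths (dom_flow p)) k"
    using k(1) by (simp add: continuous_map_path_space)
  have kW: "k y \<in> topspace (paths (dom_flow p))" "src (dom_flow p) (k y) = \<alpha>" "tgt (dom_flow p) (k y) = \<beta>"
    if "y \<in> topspace W" for y
    using k(1) continuous_map_funspace[OF k_cont] that by (auto simp: continuous_map_path_space)
  from k_cont have "continuous_map W (paths (dom_flow p)) (restrict k (topspace W))"
    by (rule continuous_map_eq) simp
  then have "is_flow_map l"
    using is_flow_glob[OF ab W inf] p'(1) u'(3) ab kW
    by (simp add: is_flow_map_def Let_def l_def \<alpha>_def \<beta>_def)
  moreover have "Cmp Flow l (glob_map a b Z W i) = u"
    using u k(2) iW u'(3,4)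
    by (intro flow_map.equality) (auto simp: l_def compose_def fun_eq_iff extensional_def PiE_iff)
  moreover have "Cmp Flow p l = v"
    using v k(3) v'(3,4) states_eq
    by (intro flow_map.equality) (auto simp: l_def compose_def fun_eq_iff extensional_def PiE_iff)
  ultimately show "\<exists>l. (is_flow_map l \<and> dom_flow l = glob a b W \<and> cod_flow l = dom_flow p) \<and>
      Cmp Flow l (glob_map a b Z W i) = u \<and> Cmp Flow p l = v"
    by (intro exI[of _ l]) (simp add: l_def)
qed

text \<open>A subspace of a Delta-generated space need not be Delta-generated. Here the states are
  discrete, so the path space is open and closed; if nonempty, it is a retract of the space of all
  paths, its complement being sent to one point \<open>c\<close>.\<close>

lemma path_space_in_Top:
  fixes X :: "'u flow"
  assumes X: "is_flow X"
  shows "path_space X a b \<in> Top"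
proof -
  define S where "S = {x \<in> topspace (paths X). src X x = a \<and> tgt X x = b}"
  have PX: "delta_generated (paths X)" "topspace (paths X) \<prec> (UNIV :: 'u set)"
    and s: "continuous_map (paths X) (discrete_topology (states X)) (src X)"
    and t: "continuous_map (paths X) (discrete_topology (states X)) (tgt X)"
    using X by (auto simp: is_flow_def Top_def)
  have open_fibre: "openin (paths X) {x \<in> topspace (paths X). f x \<in> A}"
    if "continuous_map (paths X) (discrete_topology (states X)) f" for f and A :: "'u set"
  proof -
    have "openin (paths X) {x \<in> topspace (paths X). f x \<in> A \<inter> states X}"
      using that by (rule openin_continuous_map_preimage) simp
    moreover have "{x \<in> topspace (paths X). f x \<in> A \<inter> states X} = {x \<in> topspace (paths X). f x \<in> A}"
      using that by (auto simp: continuous_map_def)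
    ultimately show ?thesis by simp
  qed
  have S: "openin (paths X) S"
  proof -
    have "S = {x \<in> topspace (paths X). src X x \<in> {a}} \<inter> {x \<in> topspace (paths X). tgt X x \<in> {b}}"
      by (auto simp: S_def)
    then show ?thesis 
      using openin_Int[OF open_fibre[OF s, of "{a}"] open_fibre[OF t, of "{b}"]] by (simp only:)
  qed
  have S': "openin (paths X) (topspace (paths X) - S)"
  proof -
    have "topspace (paths X) - S = {x \<in> topspace (paths X). src X x \<in> -{a}} \<union> {x \<in> topspace (paths X). tgt X x \<in> -{b}}"
      by (auto simp: S_def)
    then show ?thesis 
      using openin_Un[OF open_fibre[OF s, of "-{a}"] open_fibre[OF t, of "-{b}"]] by (simp only:)
  qed
  have sub: "path_space X a b = subtopology (paths X) S" "S \<subseteq> topspace (paths X)"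
    by (auto simp: path_space_def S_def)
  have "delta_generated (path_space X a b)"
  proof (cases "S = {}")
    case True
    then show ?thesis
      by (intro delta_generatedI) (auto simp: sub delta_openin_def)
  next
    case False
    then obtain c where c: "c \<in> S" by blast
    define r where "r = (\<lambda>x. if x \<in> S then x else c)"
    have "continuous_map (paths X) (paths X) r"
      unfolding continuous_map_def
    proof (intro conjI allI impI)
      fix U assume U: "openin (paths X) U"
      have "{x \<in> topspace (paths X). r x \<in> U} = U \<inter> S \<union> (if c \<in> U then topspace (paths X) - S else {})"
        using sub openin_subset[OF U] by (auto simp: r_def)
      then show "openin (paths X) {x \<in> topspace (paths X). r x \<in> U}"
        using U S S' by (simp add: openin_Un openin_Int)
    qed (use c sub in \<open>auto simp: r_def\<close>)
    then have "continuous_map (paths X) (path_space X a b) r"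
      using c by (auto simp: sub continuous_map_in_subtopology r_def)
    moreover have "continuous_map (path_space X a b) (paths X) id"
      by (simp add: sub continuous_map_from_subtopology)
    ultimately show ?thesis
      by (rule delta_generated_retract[OF PX(1)]) (simp add: sub r_def)
  qed
  moreover have "topspace (path_space X a b) \<prec> (UNIV :: 'u set)"
    by (rule lesspoll_trans1[OF subset_imp_lepoll PX(2)]) (auto simp: topspace_path_space)
  ultimately show ?thesis by (simp add: Top_def)
qed

section \<open>Classes determined by lifting\<close>

lemma weak_factorization_system_left:
  assumes "weak_factorization_system C L R"
  shows "L = {i \<in> Arr C. \<forall>p\<in>R. has_lifting C i p}"
  by (rule conjunct1[OF iffD1[OF weak_factorization_system_def assms]])

text \<open>Lifting against more maps is the stronger condition. Every inclusion between classes of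
  cofibrations or trivial cofibrations in the theorem is obtained from this.\<close>

lemma weak_factorization_system_antimono:
  assumes "weak_factorization_system C L R" "weak_factorization_system C L' R'" "R' \<subseteq> R"
  shows "L \<subseteq> L'"
  unfolding weak_factorization_system_left[OF assms(1)] weak_factorization_system_left[OF assms(2)]
  using assms(3) by blast

section \<open>Homotopy equivalences are weak homotopy equivalences\<close>

lemma continuous_map_cylinder_inclusion:
  "t \<in> {0..1} \<Longrightarrow> continuous_map X (prod_topology X unit_interval) (\<lambda>x. (x, t))"
  by (simp add: continuous_map_pairwise o_def)

context
  fixes M :: "'u flow_map model_data"
  assumes M: "is_m_model_structure M" and inf: "infinite (UNIV :: 'u set)"
begin

text \<open>The dictionary between the axioms of \<open>M\<close> and spaces; the condition on
  states holds because a map of globes fixes both states.\<close>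

lemma weqs_glob_map_iff:
  assumes "a \<noteq> b" "Z \<in> Top" "W \<in> Top" "continuous_map Z W f"
  shows "glob_map a b Z W f \<in> weqs M \<longleftrightarrow> weak_homotopy_equivalence Z W f"
proof -
  have "weqs M = {f \<in> Arr Flow. bij_betw (on_states f) (states (dom_flow f)) (states (cod_flow f)) \<and>
      locally_in weak_homotopy_equivalence f}"
    using M by (simp add: is_m_model_structure_def flow_model_structure_def)
  moreover have "bij_betw (restrict id {a, b}) {a, b} {a, b}"
    using bij_betw_id by (rule bij_betw_cong[THEN iffD1, rotated]) simp
  ultimately show ?thesis
    using is_flow_map_glob_map[OF assms(1-3) inf assms(4)]
    by (simp add: locally_weak_homotopy_equivalence_glob_map[OF assms(1)])
qed

text \<open>The second item is the delicate one: base points of \<open>Y\<close> need not lie in the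
  image of \<open>f\<close>. All three are read off from the axiom for \<open>weqs M\<close>,
  applied to maps of globes.\<close>

lemma weak_homotopy_equivalence_two_out_of_three:
  fixes X Y Z :: "'u topology"
  assumes X: "X \<in> Top" and Y: "Y \<in> Top" and Z: "Z \<in> Top"
    and f: "continuous_map X Y f" and g: "continuous_map Y Z g"
  shows "weak_homotopy_equivalence X Y f \<Longrightarrow> weak_homotopy_equivalence Y Z g \<Longrightarrow>
      weak_homotopy_equivalence X Z (g \<circ> f)"
    and "weak_homotopy_equivalence X Y f \<Longrightarrow> weak_homotopy_equivalence X Z (g \<circ> f) \<Longrightarrow>
      weak_homotopy_equivalence Y Z g"
    and "weak_homotopy_equivalence Y Z g \<Longrightarrow> weak_homotopy_equivalence X Z (g \<circ> f) \<Longrightarrow>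
      weak_homotopy_equivalence X Y f"
proof -
  obtain a b :: 'u where ab: "a \<noteq> b"
    using ex_new_if_finite[OF inf, of "{undefined}"] by auto
  have "model_structure Flow M"
    using M by (simp add: is_m_model_structure_def flow_model_structure_def)
  then have "\<forall>u\<in>Arr Flow. \<forall>v\<in>Arr Flow. Dom Flow v = Cod Flow u \<longrightarrow>
        (u \<in> weqs M \<and> v \<in> weqs M \<longrightarrow> Cmp Flow v u \<in> weqs M) \<and>
        (u \<in> weqs M \<and> Cmp Flow v u \<in> weqs M \<longrightarrow> v \<in> weqs M) \<and>
        (v \<in> weqs M \<and> Cmp Flow v u \<in> weqs M \<longrightarrow> u \<in> weqs M)"
    unfolding model_structure_def by (elim conjE)
  then have *: "(u \<in> weqs M \<and> v \<in> weqs M \<longrightarrow> Cmp Flow v u \<in> weqs M) \<and>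
        (u \<in> weqs M \<and> Cmp Flow v u \<in> weqs M \<longrightarrow> v \<in> weqs M) \<and>
        (v \<in> weqs M \<and> Cmp Flow v u \<in> weqs M \<longrightarrow> u \<in> weqs M)"
    if "is_flow_map u" "is_flow_map v" "dom_flow v = cod_flow u" for u v
    using that unfolding Flow_simps by blast
  have "Cmp Flow (glob_map a b Y Z g) (glob_map a b X Y f) = glob_map a b X Z (g \<circ> f)"
    by (rule Cmp_glob_map[OF f])
  then show
    "weak_homotopy_equivalence X Y f \<Longrightarrow> weak_homotopy_equivalence Y Z g \<Longrightarrow>
      weak_homotopy_equivalence X Z (g \<circ> f)"
    "weak_homotopy_equivalence X Y f \<Longrightarrow> weak_homotopy_equivalence X Z (g \<circ> f) \<Longrightarrow>
      weak_homotopy_equivalence Y Z g"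
    "weak_homotopy_equivalence Y Z g \<Longrightarrow> weak_homotopy_equivalence X Z (g \<circ> f) \<Longrightarrow>
      weak_homotopy_equivalence X Y f"
    using *[OF is_flow_map_glob_map[OF ab X Y inf f] is_flow_map_glob_map[OF ab Y Z inf g]]
      weqs_glob_map_iff[OF ab X Y f] weqs_glob_map_iff[OF ab Y Z g]
      weqs_glob_map_iff[OF ab X Z continuous_map_compose[OF f g]]
    by simp_all
qed

text \<open>Homotopy lifting for \<open>X\<close> says that the globe of this inclusion lifts
  against \<open>fibs M\<close>. By the second factorization system it then belongs to
  \<open>cofs M \<inter> weqs M\<close>, so no homotopy group has to be inspected. \<open>P\<close>
  is the copy of the cylinder on the type \<open>'u\<close>.\<close>

lemma weak_homotopy_equivalence_cylinder_bottom:
  fixes X P :: "'u topology"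
  assumes X: "X \<in> Top" and P: "P \<in> Top" and ed: "homeomorphic_maps (prod_topology X unit_interval) P e d"
  shows "weak_homotopy_equivalence X P (\<lambda>x. e (x, 0))"
proof -
  obtain a b :: 'u where ab: "a \<noteq> b"
    using ex_new_if_finite[OF inf, of "{undefined}"] by auto
  let ?C = "prod_topology X unit_interval"
  have e: "continuous_map ?C P e" and d: "continuous_map P ?C d"
    and de: "\<And>z. z \<in> topspace ?C \<Longrightarrow> d (e z) = z" and ed': "\<And>y. y \<in> topspace P \<Longrightarrow> e (d y) = y"
    using ed unfolding homeomorphic_maps_def by blast+
  have i: "continuous_map X P (\<lambda>x. e (x, 0))"
    using continuous_map_compose[OF continuous_map_cylinder_inclusion[of 0 X] e] by (simp add: o_def)
  define j where "j = glob_map a b X P (\<lambda>x. e (x, 0))"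
  have ms: "model_structure Flow M" and fibs: "fibs M = {f \<in> Arr Flow. locally_in h_fibration f}"
    using M by (simp_all add: is_m_model_structure_def flow_model_structure_def)
  have "has_lifting Flow j p" if "p \<in> fibs M" for p
    unfolding j_def
  proof (rule has_lifting_glob_map[OF ab X P inf i])
    show p: "is_flow_map p" using that fibs by simp
    fix \<alpha> \<beta> g h
    let ?E = "path_space (dom_flow p) \<alpha> \<beta>" and ?B = "path_space (cod_flow p) (on_states p \<alpha>) (on_states p \<beta>)"
    assume \<alpha>\<beta>: "\<alpha> \<in> states (dom_flow p)" "\<beta> \<in> states (dom_flow p)" and g: "continuous_map X ?E g"
      and h: "continuous_map P ?B h" and gh: "\<And>x. x \<in> topspace X \<Longrightarrow> on_paths p (g x) = h (e (x, 0))"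
    have "h_fibration ?E ?B (on_paths p)"
      using that fibs \<alpha>\<beta> by (simp add: locally_in_def)
    then have lift: "homotopy_lifting X ?E ?B (on_paths p)" using X by (simp add: h_fibration_def)
    \<comment> \<open>The problem is posed on \<open>X\<close> and \<open>P\<close>;
      \<open>fst\<close> and \<open>e\<close> move it to the cylinder, and \<open>d\<close> carries
      the lift back to \<open>P\<close>.\<close>
    have "continuous_map (subtopology ?C (topspace X \<times> {0})) ?E (g \<circ> fst)"
      using continuous_map_from_subtopology[OF continuous_map_fst] g by (rule continuous_map_compose)
    moreover have "continuous_map ?C ?B (h \<circ> e)" using e h by (rule continuous_map_compose)
    ultimately obtain l where l: "continuous_map ?C ?E l"
      "\<forall>w\<in>topspace X \<times> {0}. l w = (g \<circ> fst) w" "\<forall>w\<in>topspace X \<times> {0..1}. on_paths p (l w) = (h \<circ> e) w"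
      using lift[unfolded homotopy_lifting_def, rule_format, of "g \<circ> fst" "h \<circ> e"] gh by auto
    show "\<exists>l. continuous_map P ?E l \<and> (\<forall>x\<in>topspace X. l (e (x, 0)) = g x) \<and>
        (\<forall>y\<in>topspace P. on_paths p (l y) = h y)"
    proof (intro exI[of _ "l \<circ> d"] conjI ballI)
      show "continuous_map P ?E (l \<circ> d)" using d l(1) by (rule continuous_map_compose)
      show "(l \<circ> d) (e (x, 0)) = g x" if "x \<in> topspace X" for x
        using that l(2) de[of "(x, 0)"] by simp
      show "on_paths p ((l \<circ> d) y) = h y" if y: "y \<in> topspace P" for y
      proof -
        have "d y \<in> topspace X \<times> {0..1}" using d y by (auto simp: continuous_map_def)
        then have "on_paths p (l (d y)) = h (e (d y))" using l(3) by (metis o_apply)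
        then show ?thesis by (simp add: ed'[OF y])
      qed
    qed
  qed
  then have LLP: "j \<in> {j \<in> Arr Flow. \<forall>p\<in>fibs M. has_lifting Flow j p}"
    using is_flow_map_glob_map[OF ab X P inf i] by (simp add: j_def)
  have wfs: "weak_factorization_system Flow (cofs M \<inter> weqs M) (fibs M)"
    using ms unfolding model_structure_def by blast
  have "j \<in> cofs M \<inter> weqs M"
    using LLP by (rule subsetD[OF equalityD2[OF weak_factorization_system_left[OF wfs]]])
  then show ?thesis
    using weqs_glob_map_iff[OF ab X P i] by (simp add: j_def)
qed

text \<open>
  Both ends of the cylinder are sections of its projection, so that by two-out-of-three a homotopy
  from \<open>k\<close> to the identity is a weak homotopy equivalence, and with it \<open>k\<close>.
\<close>

lemma weak_homotopy_equivalence_homotopic_id: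
  fixes X :: "'u topology"
  assumes small: "(UNIV :: real set) \<prec> (UNIV :: 'u set)" and X: "X \<in> Top"
    and hom: "homotopic_with (\<lambda>_. True) X X k id"
  shows "weak_homotopy_equivalence X X k"
proof -
  let ?C = "prod_topology X unit_interval"
  have "{0..1::real} \<prec> (UNIV :: 'u set)"
    by (rule lesspoll_trans1[OF subset_imp_lepoll small]) simp
  then have "topspace ?C \<prec> (UNIV :: 'u set)"
    using X by (simp add: Top_def Times_lesspoll_UNIV)
  then obtain P :: "'u topology" and e d where P: "P \<in> Top" and ed: "homeomorphic_maps ?C P e d"
    using Top_copy[OF delta_generated_cylinder] X unfolding Top_def homeomorphic_space_def by blast
  have e: "continuous_map ?C P e" and d: "continuous_map P ?C d"
    and de: "\<And>z. z \<in> topspace ?C \<Longrightarrow> d (e z) = z"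
    using ed unfolding homeomorphic_maps_def by blast+
  obtain H where H: "continuous_map (prod_topology (top_of_set {0..1::real}) X) X H"
    "\<forall>x. H (0, x) = k x" "\<forall>x. H (1, x) = id x"
    using hom unfolding homotopic_with_def by blast
  define i where "i = (\<lambda>t x. e (x, t :: real))"
  define pr where "pr = fst \<circ> d"
  \<comment> \<open>The homotopy, read on the copy \<open>P\<close>. The swap is due to
    \<open>homotopic_with\<close>, which puts the interval in the first factor.\<close>
  define K where "K = H \<circ> (\<lambda>z. (snd z, fst z)) \<circ> d"
  have i: "continuous_map X P (i t)" if "t \<in> {0..1}" for t
    using continuous_map_compose[OF continuous_map_cylinder_inclusion[OF that] e] by (simp add: i_def o_def)
  have pr: "continuous_map P X pr"
    unfolding pr_def using d continuous_map_fst by (rule continuous_map_compose)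
  have "continuous_map ?C (prod_topology (top_of_set {0..1::real}) X) (\<lambda>z. (snd z, fst z))"
    by (simp add: continuous_map_pairwise o_def continuous_map_fst continuous_map_snd flip: unit_interval_def)
  then have K: "continuous_map P X K"
    unfolding K_def using d H(1) by (intro continuous_map_compose)
  have bottom: "weak_homotopy_equivalence X P (i 0)"
    unfolding i_def by (rule weak_homotopy_equivalence_cylinder_bottom[OF X P ed])
  have "weak_homotopy_equivalence X X id"
    \<comment> \<open>Cancelling \<open>i 0\<close> in \<open>i 0 \<circ> id = i 0\<close> yields
      even the identity without a computation of homotopy groups.\<close>
    using weak_homotopy_equivalence_two_out_of_three(3)[OF X X P continuous_map_id i[of 0]] bottom by simp
  then have whe_id: "weak_homotopy_equivalence X X f" if "\<And>x. x \<in> topspace X \<Longrightarrow> f x = x" for f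
    by (rule weak_homotopy_equivalence_cong) (simp add: that)
  have pr_i: "weak_homotopy_equivalence X X (pr \<circ> i t)" if "t \<in> {0..1}" for t
    using that by (intro whe_id) (simp add: pr_def i_def de)
  have "weak_homotopy_equivalence P X pr"
    using weak_homotopy_equivalence_two_out_of_three(2)[OF X P X i[of 0] pr] bottom pr_i[of 0] by simp
  then have "weak_homotopy_equivalence X P (i 1)"
    using weak_homotopy_equivalence_two_out_of_three(3)[OF X P X i[of 1] pr] pr_i[of 1] by simp
  \<comment> \<open>At the end 1 the homotopy is the identity, which makes \<open>K\<close> a weak
    homotopy equivalence; restricting it to the end 0 then gives \<open>k\<close>.\<close>
  moreover have "weak_homotopy_equivalence X X (K \<circ> i 1)"
    by (rule whe_id) (simp add: K_def i_def de H(3))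
  ultimately have "weak_homotopy_equivalence P X K"
    using weak_homotopy_equivalence_two_out_of_three(2)[OF X P X i[of 1] K] by simp
  then have "weak_homotopy_equivalence X X (K \<circ> i 0)"
    using weak_homotopy_equivalence_two_out_of_three(1)[OF X P X i[of 0] K] bottom by simp
  then show ?thesis
    by (rule weak_homotopy_equivalence_cong) (simp add: K_def i_def de H(2))
qed

lemma homotopy_equivalence_imp_weak_homotopy_equivalence:
  fixes X Y :: "'u topology"
  assumes small: "(UNIV :: real set) \<prec> (UNIV :: 'u set)" and X: "X \<in> Top" and Y: "Y \<in> Top"
    and f: "homotopy_equivalence X Y f"
  shows "weak_homotopy_equivalence X Y f"
proof -
  obtain g where g: "continuous_map Y X g" "homotopic_with (\<lambda>_. True) X X (g \<circ> f) id"
    "homotopic_with (\<lambda>_. True) Y Y (f \<circ> g) id" and f': "continuous_map X Y f"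
    using f unfolding homotopy_equivalence_def by blast
  \<comment> \<open>Two-out-of-six is used for the chain \<open>f\<close>, \<open>g\<close>,
    \<open>f\<close>, whose two composites are homotopic to identities.\<close>
  show ?thesis
    using weak_homotopy_equivalence_homotopic_id[OF small X g(2)]
      weak_homotopy_equivalence_homotopic_id[OF small Y g(3)]
    by (rule weak_homotopy_equivalence_two_out_of_six[OF f' g(1) f'])
qed

end

section \<open>Comparison of the three model structures\<close>

lemma flow_model_structureD:
  assumes "flow_model_structure W F M"
  shows "model_structure Flow M" "fibs M = {f \<in> Arr Flow. locally_in F f}"
    "weqs M = {f \<in> Arr Flow. bij_betw (on_states f) (states (dom_flow f)) (states (cod_flow f)) \<and>
       locally_in W f}"
  using assms unfolding flow_model_structure_def by blast+

lemma adjunction_identity_functor: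
  assumes "is_category C"
  shows "adjunction C C identity_functor identity_functor (\<lambda>X Y f. f)"
proof -
  have "is_functor C C identity_functor"
    using assms by (simp add: is_functor_def identity_functor_def is_category_def arrows_def)
  moreover have "Cmp C b (Cmp C f a) = Cmp C b (Cmp C f a)" for a b f by simp
  moreover have "bij_betw (\<lambda>f. f) A A" for A :: "'b set" using bij_betw_id[of A] by (simp add: id_def)
  ultimately show ?thesis
    by (simp add: adjunction_def identity_functor_def)
qed

theorem proposition7p8:
  fixes Mq Mm Mh :: "'u flow_map model_data"
  assumes "(UNIV :: real set) \<prec> (UNIV :: 'u set)"
    and "is_q_model_structure Mq"
    and "is_m_model_structure Mm"
    and "is_h_model_structure Mh"
  shows "(\<forall>X. cofibrant Flow Mq X \<longrightarrow> cofibrant Flow Mm X)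
    \<and> (\<forall>X. cofibrant Flow Mm X \<longrightarrow> cofibrant Flow Mh X)
    \<and> quillen_equivalence Flow Mq Flow Mm identity_functor identity_functor (\<lambda>X Y f. f)"
proof -
  note small = assms(1)
  have inf: "infinite (UNIV :: 'u set)"
    using lepoll_trans[OF _ lesspoll_imp_lepoll[OF small]] infinite_UNIV_char_0[where 'a = real]
    by (simp only: infinite_le_lepoll)
  note q = flow_model_structureD[OF assms(2)[unfolded is_q_model_structure_def]]
    and m = flow_model_structureD[OF assms(3)[unfolded is_m_model_structure_def]]
    and h = flow_model_structureD[OF assms(4)[unfolded is_h_model_structure_def]]
  have wfs: "weak_factorization_system Flow (cofs M) (fibs M \<inter> weqs M)"
    "weak_factorization_system Flow (cofs M \<inter> weqs M) (fibs M)"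
    if "model_structure Flow M" for M :: "'u flow_map model_data"
    using that unfolding model_structure_def by blast+
  note ms = q(1) m(1) h(1)
  have weqs: "weqs Mq = weqs Mm" unfolding q(3) m(3) ..
  have fibs_mq: "fibs Mm \<subseteq> fibs Mq"
    unfolding q(2) m(2) locally_in_def using h_fibration_imp_q_fibration[OF small] by blast
  have fibs_hm: "fibs Mh = fibs Mm" unfolding h(2) m(2) ..
  \<comment> \<open>The comparison on spaces is available for objects of \<open>Top\<close> only;
    path spaces of flows are such objects.\<close>
  have "weak_homotopy_equivalence (path_space (dom_flow f) a b)
      (path_space (cod_flow f) (on_states f a) (on_states f b)) (on_paths f)"
    if "is_flow_map f" "homotopy_equivalence (path_space (dom_flow f) a b)
      (path_space (cod_flow f) (on_states f a) (on_states f b)) (on_paths f)" for f :: "'u flow_map" and a b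
    using homotopy_equivalence_imp_weak_homotopy_equivalence[OF assms(3) inf small
        path_space_in_Top[OF is_flow_map_dest(1)] path_space_in_Top[OF is_flow_map_dest(2)]] that
    by blast
  then have weqs_hm: "weqs Mh \<subseteq> weqs Mm"
    unfolding h(3) m(3) locally_in_def by (auto simp only: Flow_simps)
  have "fibs Mm \<inter> weqs Mm \<subseteq> fibs Mq \<inter> weqs Mq" using fibs_mq weqs by (simp add: le_infI1)
  then have cofs_qm: "cofs Mq \<subseteq> cofs Mm"
    by (rule weak_factorization_system_antimono[OF wfs(1)[OF ms(1)] wfs(1)[OF ms(2)]])
  have triv_cofs_qm: "cofs Mq \<inter> weqs Mq \<subseteq> cofs Mm \<inter> weqs Mm"
    using fibs_mq by (rule weak_factorization_system_antimono[OF wfs(2)[OF ms(1)] wfs(2)[OF ms(2)]])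
  \<comment> \<open>With equal fibrations and fewer weak equivalences, the h-structure has fewer
    trivial fibrations and therefore more cofibrations.\<close>
  have "fibs Mh \<inter> weqs Mh \<subseteq> fibs Mm \<inter> weqs Mm" using fibs_hm weqs_hm by (simp add: le_infI2)
  then have cofs_mh: "cofs Mm \<subseteq> cofs Mh"
    by (rule weak_factorization_system_antimono[OF wfs(1)[OF ms(2)] wfs(1)[OF ms(3)]])
  have "quillen_adjunction Flow Mq Flow Mm identity_functor identity_functor (\<lambda>X Y f. f)"
    unfolding quillen_adjunction_def
  proof (intro conjI)
    show "on_arr identity_functor ` cofs Mq \<subseteq> cofs Mm"
      "on_arr identity_functor ` (cofs Mq \<inter> weqs Mq) \<subseteq> cofs Mm \<inter> weqs Mm"
      using cofs_qm triv_cofs_qm by (simp_all only: identity_functor_def functor_data.simps image_id id_apply)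
  qed (rule ms adjunction_identity_functor[OF is_category_Flow])+
  \<comment> \<open>The weak equivalences of both structures coincide and the adjunction bijection
    is the identity, so the condition on cofibrant and fibrant objects becomes a tautology.\<close>
  then have "quillen_equivalence Flow Mq Flow Mm identity_functor identity_functor (\<lambda>X Y f. f)"
    unfolding quillen_equivalence_def weqs by blast
  moreover have "cofibrant Flow Mm X" if "cofibrant Flow Mq X" for X
    using that cofs_qm unfolding cofibrant_def by blast
  moreover have "cofibrant Flow Mh X" if "cofibrant Flow Mm X" for X
    using that cofs_mh unfolding cofibrant_def by blast
  ultimately show ?thesis by blast
qed

end
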